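(* Let $K\subset\mathbb{R}^2$ be a planar convex body and let $a_1,\dots,a_n\in\mathrm{bd}\,K$. (i) If $a_1,\dots,a_n$ almost fix $K$, then both intersections $\ell(a_1)\cap\dots\cap\ell(a_n)$ and $r(a_1)\cap\dots\cap r(a_n)$ are empty. (ii) If the three intersections $\bar\ell(a_1)\cap\dots\cap\bar\ell(a_n)$, $\bar r(a_1)\cap\dots\cap\bar r(a_n)$ and $\vec\ell(a_1)\cap\dots\cap\vec\ell(a_n)$ are empty, then $a_1,\dots,a_n$ almost fix $K$.
   Context: The plane $\mathbb{R}^2$ carries its Euclidean norm; $\mathrm{bd}\,M$ and $\mathrm{int}\,M$ denote the boundary and interior of $M\subset\mathbb{R}^2$. A planar convex body is a compact convex subset of $\mathbb{R}^2$ with nonempty interior. $\mathbb{S}_1$ is the unit circle centred at the origin. $\mathrm{Isom}^+\mathbb{R}^2$ is the group of planar affine rotations and translations (orientation-preserving isometries) with its usual topology, and $\mathbf{id}$ is the identity of $\mathbb{R}^2$. Fixing: points $b_1,\dots,b_m\in\mathrm{bd}\,K$ fix $K$ if there is a neighbourhood $\mathcal{V}$ of $\mathbf{id}$ in $\mathrm{Isom}^+\mathbb{R}^2$ such that, for every $f\in\mathcal{V}$ with $f(K)\neq K$, at least one of the $b_j$ belongs to $\mathrm{int}\,f(K)$. Almost fixing: points $a_1,\dots,a_n\in\mathrm{bd}\,K$ almost fix $K$ if, for any neighbourhoods $\mathcal{V}_i$ of $a_i$ ($i=1,\dots,n$), there are pairs of points $a_i',a_i''\in\mathcal{V}_i\cap\mathrm{bd}\,K$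 ($i=1,\dots,n$) such that the $2n$ points $a_1',a_1'',\dots,a_n',a_n''$ fix $K$. Sectors: for an oriented line $D$, $D^+$ denotes the open half-plane on the left of $D$. Orient $\mathrm{bd}\,K$ counterclockwise. For $a\in\mathrm{bd}\,K$, let $T_\ell(a)$ and $T_r(a)$ be the left and right tangents to $\mathrm{bd}\,K$ at $a$ (the one-sided tangent lines on the side of $\mathrm{bd}\,K$ preceding $a$, respectively following $a$, in the counterclockwise orientation), oriented like $\mathrm{bd}\,K$, so that $\mathrm{int}\,K\subset T_\ell(a)^+\cap T_r(a)^+$. Let $N_\ell(a)$ (resp. $N_r(a)$) be the line through $a$ orthogonal to $T_\ell(a)$ (resp. $T_r(a)$), oriented in the direction pointing into $T_\ell(a)^+$ (resp. $T_r(a)^+$). Define the open sectors $$\ell(a)=N_\ell(a)^+\cap N_r(a)^+,$$ and $r(a)$ as the intersection of the two open half-planes on the right of $N_\ell(a)$ and of $N_r(a)$ (equivalently, $r(a)=\mathbb{R}^2\setminus\bar L(a)$, where $\bar L(a)$ is the closure of $N_\ell(a)^+\cup N_r(a)^+$). $\bar\ell(a)$ and $\bar r(a)$ are the corresponding closed sectors (closures of $\ell(a)$ and $r(a)$), and $\vec\ell(a)=\{x\in\mathbb{S}_1 : a+x\in\bar\ell(a)\}$. *)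

theory Defs
  imports "HOL-Analysis.Analysis"
begin

definition isom_plus :: "(real^2 \<Rightarrow> real^2) set" where
  "isom_plus = {f. \<exists>A v. rotation_matrix A \<and> f = (\<lambda>x. A *v x + v)}"

(* isom_plus carries the subspace topology of the function space real^2 => real^2, i.e.
   pointwise convergence. The next lemma shows that this is the usual topology, the one given
   by the rotation matrix A and the translation vector v. *)

lemma isom_plus_homeomorphism:
  "homeomorphism ({A :: real^2^2. rotation_matrix A} \<times> UNIV) isom_plus
     (\<lambda>(A, v) x. A *v x + v) (\<lambda>f. (matrix (\<lambda>x. f x - f 0), f 0))"
proof -
  have 1: "continuous_on ({A :: real^2^2. rotation_matrix A} \<times> UNIV)
      (\<lambda>p x. fst p *v x + snd p)"
    unfolding matrix_vector_mult_def
    by (intro continuous_on_coordinatewise_then_product continuous_intros)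
  have ev: "continuous_on isom_plus (\<lambda>f. f x)" for x :: "real^2"
    by (rule continuous_on_subset[OF continuous_on_product_coordinates]) auto
  have 2: "continuous_on isom_plus
      (\<lambda>f. (matrix (\<lambda>x. f x - f 0) :: real^2^2, f 0 :: real^2))"
    unfolding matrix_def by (intro continuous_intros ev)
  show ?thesis
  proof (rule homeomorphismI)
    show "(\<lambda>(A, v) x. A *v x + v) ` ({A. rotation_matrix A} \<times> UNIV) \<subseteq> isom_plus"
      by (rule image_subsetI, clarsimp simp: isom_plus_def, rule exI, erule conjI) (rule exI, rule refl)
  next
    show "(\<lambda>f. (matrix (\<lambda>x. f x - f 0), f 0)) ` isom_plus
        \<subseteq> {A. rotation_matrix A} \<times> UNIV"
      by (auto simp: isom_plus_def matrix_of_matrix_vector_mul)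
  qed (use 1 2 in \<open>auto simp: isom_plus_def case_prod_unfold matrix_of_matrix_vector_mul\<close>)
qed

definition fixes_body :: "(real^2) set \<Rightarrow> (real^2) set \<Rightarrow> bool" where
  "fixes_body K B \<longleftrightarrow> finite B \<and> B \<subseteq> frontier K \<and>
     (\<exists>V. openin (top_of_set isom_plus) V \<and> id \<in> V \<and>
        (\<forall>f\<in>V. f ` K \<noteq> K \<longrightarrow> (\<exists>b\<in>B. b \<in> interior (f ` K))))"

definition almost_fixes_body :: "(real^2) set \<Rightarrow> nat \<Rightarrow> (nat \<Rightarrow> real^2) \<Rightarrow> bool" where
  "almost_fixes_body K n a \<longleftrightarrow> (\<forall>i\<in>{1..n}. a i \<in> frontier K) \<and>
     (\<forall>V. (\<forall>i\<in>{1..n}. open (V i) \<and> a i \<in> V i) \<longrightarrow>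
        (\<exists>a' a''. (\<forall>i\<in>{1..n}. a' i \<in> V i \<inter> frontier K \<and> a'' i \<in> V i \<inter> frontier K) \<and>
           fixes_body K (a' ` {1..n} \<union> a'' ` {1..n})))"

definition cross2 :: "real^2 \<Rightarrow> real^2 \<Rightarrow> real" where
  "cross2 u v = u$1 * v$2 - u$2 * v$1"

definition quarter_turn :: "real^2 \<Rightarrow> real^2" where
  "quarter_turn u = vector [- u$2, u$1]"

(* An oriented line is given by a point p on it and a direction vector d. *)

definition left_half_plane :: "real^2 \<Rightarrow> real^2 \<Rightarrow> (real^2) set" where
  "left_half_plane p d = {x. cross2 d (x - p) > 0}"

definition right_half_plane :: "real^2 \<Rightarrow> real^2 \<Rightarrow> (real^2) set" where
  "right_half_plane p d = {x. cross2 d (x - p) < 0}"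

(* The boundary of a convex body, seen from an interior point z, is traversed counterclockwise
   as the polar angle around z increases. The points of following_arc K z a are reached from a
   by increasing this angle by an amount in (0, pi), those of preceding_arc K z a by decreasing
   it. Near a these arcs do not depend on the choice of z. *)

definition following_arc :: "(real^2) set \<Rightarrow> real^2 \<Rightarrow> real^2 \<Rightarrow> (real^2) set" where
  "following_arc K z a = {p \<in> frontier K. cross2 (a - z) (p - z) > 0}"

definition preceding_arc :: "(real^2) set \<Rightarrow> real^2 \<Rightarrow> real^2 \<Rightarrow> (real^2) set" where
  "preceding_arc K z a = {p \<in> frontier K. cross2 (a - z) (p - z) < 0}"

(* Unit direction vectors of the one-sided tangents at a, as limits of directions of secants
   that are oriented like the boundary (hence a - p for p preceding a). *)

definition left_tangent :: "(real^2) set \<Rightarrow> real^2 \<Rightarrow> real^2" where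
  "left_tangent K a = (THE u. \<forall>z\<in>interior K.
     ((\<lambda>p. sgn (a - p)) \<longlongrightarrow> u) (at a within preceding_arc K z a))"

definition right_tangent :: "(real^2) set \<Rightarrow> real^2 \<Rightarrow> real^2" where
  "right_tangent K a = (THE u. \<forall>z\<in>interior K.
     ((\<lambda>p. sgn (p - a)) \<longlongrightarrow> u) (at a within following_arc K z a))"

(* The normal to the line with direction u that points into its left half-plane has direction
   quarter_turn u. *)

definition left_sector :: "(real^2) set \<Rightarrow> real^2 \<Rightarrow> (real^2) set" where
  "left_sector K a =
     left_half_plane a (quarter_turn (left_tangent K a)) \<inter>
     left_half_plane a (quarter_turn (right_tangent K a))"

definition right_sector :: "(real^2) set \<Rightarrow> real^2 \<Rightarrow> (real^2) set" where
  "right_sector K a =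
     right_half_plane a (quarter_turn (left_tangent K a)) \<inter>
     right_half_plane a (quarter_turn (right_tangent K a))"

definition left_directions :: "(real^2) set \<Rightarrow> real^2 \<Rightarrow> (real^2) set" where
  "left_directions K a = {x \<in> sphere 0 1. a + x \<in> closure (left_sector K a)}"

end

theory Submission
  imports Defs
begin

text \<open>
  To first order an isometry close to the identity moves the point \<open>x\<close> with the velocity
  \<open>\<omega> J x + \<tau>\<close>, where \<open>J\<close> is the quarter turn. A boundary point \<open>b\<close> is pushed into the interior as
  soon as its velocity is an inward direction at \<open>b\<close>, i.e. has negative inner product with all
  outward normals at \<open>b\<close>; so finitely many points fix \<open>K\<close> if for every \<open>(\<omega>, \<tau>)\<close> on the unit sphere
  one of them has an inward velocity.

  For (ii), choose points tending to each \<open>a\<^sub>i\<close> from both sides. The normals at these points tend to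
  the normals of the one-sided tangents at \<open>a\<^sub>i\<close>, so if these points failed to fix \<open>K\<close>, compactness
  would give \<open>(\<omega>, \<tau>)\<close> for which no \<open>a\<^sub>i\<close> has a velocity pointing strictly inward with respect to one
  of its tangents. The centre of the corresponding rotation, or the direction normal to the
  translation, lies in one of the three intersections.

  For (i), if \<open>c\<close> lies in all open sectors, the rotations about \<open>c\<close> in one direction push every
  boundary point near every \<open>a\<^sub>i\<close> out of \<open>K\<close>, so they must preserve \<open>K\<close>. The sectors being open,
  this also holds for a second centre, and the two rotations differ by a translation, which cannot
  preserve a compact set.
\<close>

section \<open>Quarter turns and the cross product in the plane\<close>

lemma cross2_eq_inner: "cross2 u v = quarter_turn u \<bullet> v"
  by (simp add: cross2_def quarter_turn_def inner_vec_def sum_2)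

lemma inner_2: "(u :: real^2) \<bullet> v = u$1 * v$1 + u$2 * v$2"
  by (simp add: inner_vec_def sum_2)

lemma quarter_turn_nth [simp]: "quarter_turn u $ 1 = - u$2" "quarter_turn u $ 2 = u$1"
  by (simp_all add: quarter_turn_def)

lemma linear_quarter_turn: "linear quarter_turn"
  by (rule linearI) (simp_all add: vec_eq_iff forall_2)

lemmas quarter_turn_add = linear_add[OF linear_quarter_turn]
lemmas quarter_turn_diff = linear_diff[OF linear_quarter_turn]
lemmas quarter_turn_scaleR = linear_cmul[OF linear_quarter_turn]
lemmas quarter_turn_minus = linear_neg[OF linear_quarter_turn]

lemma continuous_on_quarter_turn [continuous_intros]:
  "continuous_on S f \<Longrightarrow> continuous_on S (\<lambda>x. quarter_turn (f x))"
  by (rule bounded_linear.continuous_on[OF linear_quarter_turn[unfolded linear_conv_bounded_linear]])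

lemma tendsto_quarter_turn [tendsto_intros]:
  "(f \<longlongrightarrow> l) F \<Longrightarrow> ((\<lambda>x. quarter_turn (f x)) \<longlongrightarrow> quarter_turn l) F"
  by (rule bounded_linear.tendsto[OF linear_quarter_turn[unfolded linear_conv_bounded_linear]])

lemma tendsto_cross2 [tendsto_intros]:
  "(f \<longlongrightarrow> u) F \<Longrightarrow> (g \<longlongrightarrow> v) F \<Longrightarrow> ((\<lambda>x. cross2 (f x) (g x)) \<longlongrightarrow> cross2 u v) F"
  unfolding cross2_eq_inner by (intro tendsto_intros)

lemma quarter_turn_quarter_turn [simp]: "quarter_turn (quarter_turn x) = - x"
  by (simp add: vec_eq_iff forall_2)

lemma inner_quarter_turn [simp]: "quarter_turn x \<bullet> quarter_turn y = x \<bullet> y"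
  by (simp add: inner_2)

lemma norm_quarter_turn [simp]: "norm (quarter_turn x) = norm x"
  by (simp add: norm_eq_sqrt_inner)

lemma cross2_quarter_turn [simp]:
  "cross2 (quarter_turn u) v = - (u \<bullet> v)" "cross2 u (quarter_turn v) = u \<bullet> v"
  by (simp_all add: cross2_eq_inner)

lemma inner_quarter_turn_right: "u \<bullet> quarter_turn v = - cross2 u v"
  by (simp add: cross2_def inner_2 algebra_simps)

lemma cross2_minus [simp]: "cross2 (- u) v = - cross2 u v" "cross2 u (- v) = - cross2 u v"
  by (simp_all add: cross2_def)

lemma cross2_self [simp]: "cross2 u u = 0"
  by (simp add: cross2_def)

lemma cross2_commute: "cross2 v u = - cross2 u v"
  by (simp add: cross2_def)

text \<open>The vectors \<open>u\<close> and \<open>quarter_turn u\<close> form an orthonormal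
  basis, and the component of \<open>\<nu>\<close> along \<open>u\<close> vanishes.\<close>

lemma orthogonal_unit_vector:
  assumes "norm u = 1" "\<nu> \<bullet> u = 0"
  obtains c where "\<nu> = c *\<^sub>R quarter_turn u"
proof (rule that)
  have "\<nu> = (u \<bullet> u) *\<^sub>R \<nu>"
    using assms(1) by (simp add: norm_eq_1)
  also have "\<dots> = (\<nu> \<bullet> u) *\<^sub>R u + (\<nu> \<bullet> quarter_turn u) *\<^sub>R quarter_turn u"
    by (simp add: vec_eq_iff forall_2 inner_2 algebra_simps)
  also have "\<dots> = (\<nu> \<bullet> quarter_turn u) *\<^sub>R quarter_turn u"
    by (simp add: assms(2))
  finally show "\<nu> = (\<nu> \<bullet> quarter_turn u) *\<^sub>R quarter_turn u" .
qed

text \<open>If the sequence stayed away from \<open>u\<close> infinitely often, compactness would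
  give a subsequence converging to some other limit.\<close>

lemma tendsto_if_subseq_limits_eq:
  fixes f :: "nat \<Rightarrow> 'a::metric_space"
  assumes "compact S" "\<And>k. f k \<in> S"
    and lim: "\<And>r l. strict_mono (r :: nat \<Rightarrow> nat) \<Longrightarrow> (f \<circ> r) \<longlonglongrightarrow> l \<Longrightarrow> l = u"
  shows "f \<longlonglongrightarrow> u"
proof (rule ccontr)
  assume "\<not> f \<longlonglongrightarrow> u"
  then obtain e where e: "e > 0" "\<And>N. \<exists>n\<ge>N. dist (f n) u \<ge> e"
    unfolding lim_sequentially by (meson not_less)
  then have "infinite {n. dist (f n) u \<ge> e}"
    by (simp add: infinite_nat_iff_unbounded_le)
  then obtain r :: "nat \<Rightarrow> nat" where r: "strict_mono r" "\<And>n. dist (f (r n)) u \<ge> e"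
    using infinite_enumerate by blast
  have "\<forall>n. (f \<circ> r) n \<in> S" using assms(2) by simp
  then obtain l r' where "l \<in> S" and l: "strict_mono r'" "(f \<circ> r \<circ> r') \<longlonglongrightarrow> l"
    by (rule seq_compactE[OF compact_imp_seq_compact[OF assms(1)]])
  have "l = u"
    using lim[of "r \<circ> r'"] r(1) l by (simp add: strict_mono_o o_assoc)
  then have "\<forall>\<^sub>F n in sequentially. dist (f (r (r' n))) u < e"
    using tendstoD[OF l(2) e(1)] by simp
  then show False
    using r(2) by (simp add: not_less[THEN iffD2])
qed

section \<open>Orientation-preserving isometries\<close>

text \<open>A homeomorphism preserves interiors. This turns a question about the interior of a moved
  body into one about the point moved back.\<close>

lemma mem_interior_image_iff:
  fixes f :: "'a::topological_space \<Rightarrow> 'b::topological_space"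
  assumes "continuous_on UNIV f" "continuous_on UNIV g" "\<And>x. f (g x) = x" "\<And>x. g (f x) = x"
  shows "b \<in> interior (f ` S) \<longleftrightarrow> g b \<in> interior S"
proof -
  have image: "f ` T = g -` T" for T by (auto simp: assms(4)) (metis assms(3) image_eqI)
  have "open (g -` interior S)" "open (f -` interior (f ` S))"
    using assms(1,2) by (auto intro: open_vimage)
  moreover have "g -` interior S \<subseteq> f ` S"
    unfolding image using interior_subset by blast
  moreover have "f -` interior (f ` S) \<subseteq> S"
    using interior_subset[of "f ` S"] unfolding image by (auto simp: assms(4))
  ultimately have "g -` interior S \<subseteq> interior (f ` S)" "f -` interior (f ` S) \<subseteq> interior S"
    by (simp_all add: interior_maximal)
  then show ?thesis using assms(3)[of b] by auto
qed

lemma isom_plus_iff: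
  "f \<in> isom_plus \<longleftrightarrow> (\<exists>c s v. c\<^sup>2 + s\<^sup>2 = 1 \<and> f = (\<lambda>x. c *\<^sub>R x + s *\<^sub>R quarter_turn x + v))"
proof
  assume "f \<in> isom_plus"
  then obtain A v where A: "orthogonal_matrix A" "det A = 1" and f: "f = (\<lambda>x. A *v x + v)"
    by (auto simp: isom_plus_def rotation_matrix_def)
  have "transpose A ** A = mat 1" using A(1) by (simp add: orthogonal_matrix_def)
  then have 1: "A$1$1 * A$1$1 + A$2$1 * A$2$1 = 1" "A$1$2 * A$1$2 + A$2$2 * A$2$2 = 1"
    by (simp_all add: vec_eq_iff forall_2 matrix_matrix_mult_def transpose_def mat_def sum_2)
  have "A$1$1 * A$2$2 - A$1$2 * A$2$1 = 1" using A(2) by (simp add: det_2)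
  \<comment> \<open>This sum of squares expands to the two column norms minus twice the determinant,
    that is 1 + 1 - 2.\<close>
  then have "(A$1$1 - A$2$2)\<^sup>2 + (A$1$2 + A$2$1)\<^sup>2 = 0"
    using 1 by (simp add: power2_eq_square algebra_simps)
  then have 2: "A$2$2 = A$1$1" "A$1$2 = - A$2$1"
    by (simp_all add: sum_power2_eq_zero_iff)
  have "A *v x = A$1$1 *\<^sub>R x + A$2$1 *\<^sub>R quarter_turn x" for x
    by (simp add: vec_eq_iff forall_2 matrix_vector_mult_def sum_2 2)
  moreover have "(A$1$1)\<^sup>2 + (A$2$1)\<^sup>2 = 1" using 1(1) by (simp add: power2_eq_square)
  ultimately show "\<exists>c s v. c\<^sup>2 + s\<^sup>2 = 1 \<and> f = (\<lambda>x. c *\<^sub>R x + s *\<^sub>R quarter_turn x + v)"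
    unfolding f by metis
next
  assume "\<exists>c s v. c\<^sup>2 + s\<^sup>2 = 1 \<and> f = (\<lambda>x. c *\<^sub>R x + s *\<^sub>R quarter_turn x + v)"
  then obtain c s v where cs: "c\<^sup>2 + s\<^sup>2 = 1" and f: "f = (\<lambda>x. c *\<^sub>R x + s *\<^sub>R quarter_turn x + v)"
    by blast
  define A :: "real^2^2" where "A = vector [vector [c, - s], vector [s, c]]"
  have A: "A$1$1 = c" "A$1$2 = - s" "A$2$1 = s" "A$2$2 = c" by (simp_all add: A_def)
  have "rotation_matrix A"
    using cs by (simp add: rotation_matrix_def orthogonal_matrix_def det_2 A vec_eq_iff forall_2
        matrix_matrix_mult_def transpose_def mat_def sum_2 power2_eq_square algebra_simps)
  moreover have "f = (\<lambda>x. A *v x + v)"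
    by (simp add: f fun_eq_iff vec_eq_iff forall_2 matrix_vector_mult_def sum_2 A)
  ultimately show "f \<in> isom_plus" by (auto simp: isom_plus_def)
qed

text \<open>The rotation about \<open>c\<close> by the angle \<open>2 arctan q\<close>.\<close>

definition rotation_about :: "real \<Rightarrow> real^2 \<Rightarrow> real^2 \<Rightarrow> real^2" where
  "rotation_about q c x =
     c + ((1 - q\<^sup>2) / (1 + q\<^sup>2)) *\<^sub>R (x - c) + (2 * q / (1 + q\<^sup>2)) *\<^sub>R quarter_turn (x - c)"

text \<open>The coefficients are the cosine and sine of 2 arctan \<open>q\<close>; the half-angle
  form makes everything rational in \<open>q\<close> and avoids trigonometry.\<close>

lemma rational_circle_point: "((1 - q\<^sup>2) / (1 + q\<^sup>2))\<^sup>2 + (2 * q / (1 + q\<^sup>2))\<^sup>2 = (1::real)"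
proof -
  have "1 + q\<^sup>2 \<noteq> 0" by (metis add_pos_nonneg less_numeral_extra(1,3) zero_le_power2)
  moreover have "(1 - q\<^sup>2)\<^sup>2 + (2 * q)\<^sup>2 = (1 + q\<^sup>2)\<^sup>2" by (simp add: power2_eq_square algebra_simps)
  ultimately show ?thesis by (simp add: power_divide flip: add_divide_distrib)
qed

lemma rotation_about_isom_plus: "rotation_about q c \<in> isom_plus"
  unfolding isom_plus_iff
proof (intro exI conjI)
  let ?C = "(1 - q\<^sup>2) / (1 + q\<^sup>2)" and ?S = "2 * q / (1 + q\<^sup>2)"
  show "?C\<^sup>2 + ?S\<^sup>2 = 1" by (rule rational_circle_point)
  show "rotation_about q c = (\<lambda>x. ?C *\<^sub>R x + ?S *\<^sub>R quarter_turn x + (c - ?C *\<^sub>R c - ?S *\<^sub>R quarter_turn c))"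
    by (simp add: rotation_about_def fun_eq_iff scaleR_diff_right quarter_turn_diff)
qed

lemma rotation_about_inverse: "rotation_about (- q) c (rotation_about q c x) = x"
proof -
  define C S where "C = (1 - q\<^sup>2) / (1 + q\<^sup>2)" and "S = 2 * q / (1 + q\<^sup>2)"
  have CS: "C * C + S * S = 1"
    using rational_circle_point[of q] by (simp add: C_def S_def power2_eq_square)
  have "rotation_about (- q) c (rotation_about q c x) = c + (C * C + S * S) *\<^sub>R (x - c)"
    by (simp add: rotation_about_def flip: C_def S_def)
      (simp add: quarter_turn_add quarter_turn_diff quarter_turn_scaleR algebra_simps)
  then show ?thesis by (simp add: CS)
qed

lemma rotation_about_zero: "rotation_about 0 c = id"
  by (simp add: rotation_about_def fun_eq_iff)

lemma continuous_on_rotation_about: "continuous_on UNIV (rotation_about q c)"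
  unfolding rotation_about_def by (intro continuous_intros)

lemma continuous_on_rotation_about_angle: "continuous_on UNIV (\<lambda>q. rotation_about q c)"
proof (rule continuous_on_coordinatewise_then_product)
  have "1 + q\<^sup>2 \<noteq> 0" for q :: real by (metis add_pos_nonneg less_numeral_extra(1,3) zero_le_power2)
  then show "continuous_on UNIV (\<lambda>q. rotation_about q c x)" for x
    unfolding rotation_about_def by (intro continuous_intros) auto
qed

lemma mem_interior_rotation_about:
  "b \<in> interior (rotation_about q c ` S) \<longleftrightarrow> rotation_about (- q) c b \<in> interior S"
  using rotation_about_inverse[of q] rotation_about_inverse[of "- q"]
  by (intro mem_interior_image_iff continuous_on_rotation_about) auto

text \<open>The rotations about \<open>c\<close> form a path that is continuous for pointwise
  convergence and starts at \<open>id\<close>. The factor \<open>s\<close> will be a sign, the sense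
  of rotation.\<close>

lemma eventually_rotation_about:
  assumes "openin (top_of_set isom_plus) V" "id \<in> V"
  shows "\<forall>\<^sub>F q in at_right 0. rotation_about (s * q) c \<in> V"
proof -
  obtain T where T: "open T" "V = isom_plus \<inter> T" using assms(1) by (auto simp: openin_open)
  have "continuous_on UNIV (\<lambda>q. rotation_about (s * q) c)"
    using continuous_on_compose2[OF continuous_on_rotation_about_angle, of UNIV "\<lambda>q. s * q"]
    by (simp add: continuous_on_mult_left continuous_on_id)
  then have "open ((\<lambda>q. rotation_about (s * q) c) -` T)" using T(1) by (rule open_vimage[rotated])
  moreover have "0 \<in> (\<lambda>q. rotation_about (s * q) c) -` T"
    using assms(2) T(2) by (simp add: rotation_about_zero)
  ultimately have "\<forall>\<^sub>F q in at_right 0. q \<in> (\<lambda>q. rotation_about (s * q) c) -` T"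
    by (auto simp: eventually_at_topological)
  then show ?thesis
    by eventually_elim (simp add: T(2) rotation_about_isom_plus)
qed

section \<open>Sectors\<close>

text \<open>Moving \<open>x\<close> slightly along \<open>e\<close> makes both weak inequalities
  strict.\<close>

lemma mem_closure_open_sector:
  fixes u v e x a :: "'a::real_inner"
  assumes "u \<bullet> e < 0" "v \<bullet> e < 0" "u \<bullet> (x - a) \<le> 0" "v \<bullet> (x - a) \<le> 0"
  shows "x \<in> closure {y. u \<bullet> (y - a) < 0 \<and> v \<bullet> (y - a) < 0}" (is "_ \<in> closure ?S")
proof -
  have lim: "((\<lambda>t. x + t *\<^sub>R e) \<longlongrightarrow> x + 0 *\<^sub>R e) (at_right 0)" by (intro tendsto_intros)
  have "x + t *\<^sub>R e \<in> ?S" if "t > 0" for t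
  proof -
    have "w \<bullet> (x + t *\<^sub>R e - a) = w \<bullet> (x - a) + t * (w \<bullet> e)" for w
      by (simp add: inner_add_right inner_diff_right)
    then show ?thesis
      using assms that mult_pos_neg[of t "u \<bullet> e"] mult_pos_neg[of t "v \<bullet> e"] by simp
  qed
  then have "\<forall>\<^sub>F t in at_right 0. x + t *\<^sub>R e \<in> closure ?S"
    using closure_subset[of ?S] by (auto intro!: eventually_at_rightI[of 0 1])
  then have "x + 0 *\<^sub>R e \<in> closure ?S"
    by (intro Lim_in_closed_set[OF closed_closure _ _ lim]) auto
  then show ?thesis by simp
qed

text \<open>To the left of an inward normal means behind the tangent, because
  \<open>cross2 (quarter_turn u) v\<close> equals \<open>- (u \<bullet> v)\<close>.\<close>

lemma left_sector_eq:
  "left_sector K a = {x. left_tangent K a \<bullet> (x - a) < 0 \<and> right_tangent K a \<bullet> (x - a) < 0}"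
  by (auto simp: left_sector_def left_half_plane_def)

lemma right_sector_eq:
  "right_sector K a = {x. left_tangent K a \<bullet> (x - a) > 0 \<and> right_tangent K a \<bullet> (x - a) > 0}"
  by (auto simp: right_sector_def right_half_plane_def)

lemma open_left_sector: "open (left_sector K a)"
  unfolding left_sector_eq by (intro open_Collect_conj open_Collect_less continuous_intros)

lemma open_right_sector: "open (right_sector K a)"
  unfolding right_sector_eq by (intro open_Collect_conj open_Collect_less continuous_intros)

section \<open>One-sided tangents and normals\<close>

text \<open>The unit vectors of the normal cone of \<open>K\<close> at \<open>b\<close>.\<close>

definition unit_normals :: "(real^2) set \<Rightarrow> real^2 \<Rightarrow> (real^2) set" where
  "unit_normals K b = {\<nu>. norm \<nu> = 1 \<and> (\<forall>x\<in>K. \<nu> \<bullet> (x - b) \<le> 0)}"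

text \<open>One positive \<open>t\<close> is enough: if \<open>K\<close> is convex and contains
  \<open>b\<close>, all smaller positive parameters give interior points too.\<close>

definition inward_directions :: "(real^2) set \<Rightarrow> real^2 \<Rightarrow> (real^2) set" where
  "inward_directions K b = {w. \<exists>t>0. b + t *\<^sub>R w \<in> interior K}"

text \<open>The sign \<open>\<sigma> = 1\<close> stands for the right tangent and the following arc, \<open>\<sigma> = -1\<close> for
  the left tangent and the preceding arc.\<close>

definition tangent_direction :: "real \<Rightarrow> (real^2) set \<Rightarrow> real^2 \<Rightarrow> real^2 \<Rightarrow> bool" where
  "tangent_direction \<sigma> K a u \<longleftrightarrow> norm u = 1 \<and> (\<forall>x\<in>K. cross2 u (x - a) \<ge> 0) \<and>
     (\<forall>\<nu>\<in>unit_normals K a. \<sigma> * (\<nu> \<bullet> u) \<le> 0)"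

definition boundary_arc :: "real \<Rightarrow> (real^2) set \<Rightarrow> real^2 \<Rightarrow> real^2 \<Rightarrow> (real^2) set" where
  "boundary_arc \<sigma> K z a = {p \<in> frontier K. \<sigma> * cross2 (a - z) (p - z) > 0}"

section \<open>Supporting normals of a planar convex body\<close>

locale planar_body =
  fixes K :: "(real^2) set"
  assumes compact_K: "compact K" and convex_K: "convex K" and interior_K: "interior K \<noteq> {}"
begin

lemma frontier_subset: "frontier K \<subseteq> K"
  using compact_K compact_imp_closed frontier_subset_closed by blast

lemma frontier_notin_interior: "b \<in> frontier K \<Longrightarrow> b \<notin> interior K"
  by (simp add: frontier_def)

text \<open>A ball around \<open>z\<close> fits into \<open>K\<close>, and moving from
  \<open>z\<close> by its radius along \<open>\<nu>\<close> raises the inner product by that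
  radius.\<close>

lemma unit_normal_interior:
  assumes "\<nu> \<in> unit_normals K b" "z \<in> interior K"
  shows "\<nu> \<bullet> (z - b) < 0"
proof -
  obtain e where e: "e > 0" "cball z e \<subseteq> K"
    using assms(2) mem_interior_cball by blast
  have n: "norm \<nu> = 1" using assms(1) by (simp add: unit_normals_def)
  then have "z + e *\<^sub>R \<nu> \<in> K"
    using e by (intro subsetD[OF e(2)]) (simp add: dist_norm)
  then have "\<nu> \<bullet> (z + e *\<^sub>R \<nu> - b) \<le> 0"
    using assms(1) by (simp add: unit_normals_def)
  moreover have "\<nu> \<bullet> (z + e *\<^sub>R \<nu> - b) = \<nu> \<bullet> (z - b) + e"
    using n by (simp add: inner_diff_right inner_add_right norm_eq_1)
  ultimately show ?thesis using e by linarith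
qed

text \<open>The open ray from \<open>b\<close> along \<open>w\<close> misses the interior, so a line
  separates the two. This line passes through \<open>b\<close>, which belongs to \<open>K\<close>
  and is the end of the ray, so its normal supports \<open>K\<close> there.\<close>

lemma unit_normal_if_not_inward:
  assumes "b \<in> K" "w \<notin> inward_directions K b"
  obtains \<nu> where "\<nu> \<in> unit_normals K b" "\<nu> \<bullet> w \<ge> 0"
proof -
  let ?T = "(\<lambda>t. b + t *\<^sub>R w) ` {0<..}"
  have T: "?T = (+) b ` ((\<lambda>t. t *\<^sub>R w) ` {0<..})" by (simp add: image_image)
  have "convex ?T"
    unfolding T by (intro convex_translation convex_linear_image) (auto intro: linearI simp: algebra_simps)
  moreover have "interior K \<inter> ?T = {}"
    using assms(2) by (auto simp: inward_directions_def)
  ultimately have "\<exists>\<mu> \<beta>. \<mu> \<noteq> 0 \<and> (\<forall>x\<in>interior K. \<mu> \<bullet> x \<le> \<beta>) \<and> (\<forall>x\<in>?T. \<mu> \<bullet> x \<ge> \<beta>)"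
    using interior_K by (intro separating_hyperplane_sets convex_interior convex_K) auto
  then obtain \<mu> \<beta> where \<mu>: "\<mu> \<noteq> 0" "\<And>x. x \<in> interior K \<Longrightarrow> \<mu> \<bullet> x \<le> \<beta>"
      "\<And>t. t > 0 \<Longrightarrow> \<mu> \<bullet> (b + t *\<^sub>R w) \<ge> \<beta>"
    by blast
  have K: "\<mu> \<bullet> x \<le> \<beta>" if "x \<in> K" for x
  proof -
    have "interior K \<subseteq> {x. \<mu> \<bullet> x \<le> \<beta>}" using \<mu>(2) by auto
    then have "closure (interior K) \<subseteq> {x. \<mu> \<bullet> x \<le> \<beta>}"
      by (simp add: closed_halfspace_le closure_minimal)
    then show ?thesis
      using that convex_closure_interior[OF convex_K interior_K] closure_subset by blast
  qed
  \<comment> \<open>Letting \<open>t\<close> tend to 0 gives one inequality at \<open>b\<close>, and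
    membership of \<open>b\<close> in \<open>K\<close> gives the other.\<close>
  have "((\<lambda>t. \<mu> \<bullet> (b + t *\<^sub>R w)) \<longlongrightarrow> \<mu> \<bullet> (b + 0 *\<^sub>R w)) (at_right 0)"
    by (intro tendsto_intros)
  then have "\<mu> \<bullet> (b + 0 *\<^sub>R w) \<ge> \<beta>"
    by (rule tendsto_lowerbound) (auto simp: eventually_at_right_less intro!: eventually_at_rightI[of 0 1] \<mu>(3))
  then have b: "\<mu> \<bullet> b = \<beta>" using K[OF assms(1)] by simp
  have "\<mu> \<bullet> w \<ge> 0" using \<mu>(3)[of 1] b by (simp add: inner_add_right)
  then have "sgn \<mu> \<bullet> w \<ge> 0" by (simp add: sgn_div_norm)
  moreover have "sgn \<mu> \<bullet> (x - b) \<le> 0" if "x \<in> K" for x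
    using K[OF that] b \<mu>(1) by (simp add: sgn_div_norm inner_diff_right mult_nonneg_nonpos divide_simps)
  ultimately show ?thesis
    using that[of "sgn \<mu>"] \<mu>(1) by (simp add: unit_normals_def norm_sgn)
qed

text \<open>At a boundary point the zero direction is not inward.\<close>

lemma unit_normal_frontier:
  assumes "b \<in> frontier K"
  obtains \<nu> where "\<nu> \<in> unit_normals K b"
  using unit_normal_if_not_inward[of b 0] assms frontier_subset frontier_notin_interior
  by (auto simp: inward_directions_def)

text \<open>Orthogonality comes from a squeeze: \<open>\<mu>\<close> supports \<open>K\<close> at
  \<open>a\<close> and is tested on \<open>p k\<close>, while \<open>\<nu> k\<close> supports
  \<open>K\<close> at \<open>p k\<close> and is tested on \<open>a\<close>. The two signs are
  opposite.\<close>

lemma unit_normals_secant_limit: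
  assumes \<sigma>: "\<sigma> = 1 \<or> \<sigma> = -1" and a: "a \<in> K" and p: "\<And>k. p k \<in> K" and pa: "p \<longlonglongrightarrow> a"
    and u: "(\<lambda>k. sgn (\<sigma> *\<^sub>R (p k - a))) \<longlonglongrightarrow> u"
    and \<nu>: "\<And>k. \<nu> k \<in> unit_normals K (p k)" "\<nu> \<longlonglongrightarrow> \<mu>"
  shows "\<mu> \<in> unit_normals K a" "\<mu> \<bullet> u = 0"
proof -
  have "norm \<mu> = 1"
    using tendsto_norm[OF \<nu>(2)] \<nu>(1) by (simp add: unit_normals_def LIMSEQ_const_iff)
  moreover have "\<mu> \<bullet> (x - a) \<le> 0" if "x \<in> K" for x
  proof (rule tendsto_upperbound)
    show "(\<lambda>k. \<nu> k \<bullet> (x - p k)) \<longlonglongrightarrow> \<mu> \<bullet> (x - a)" by (intro tendsto_intros \<nu> pa)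
  qed (use \<nu>(1) that in \<open>auto simp: unit_normals_def\<close>)
  ultimately show \<mu>: "\<mu> \<in> unit_normals K a" by (simp add: unit_normals_def)
  \<comment> \<open>The outer factor \<open>\<sigma>\<close> cancels the orientation of the secant,
    so the sign is that of \<open>x \<bullet> (p k - a)\<close>.\<close>
  have s: "\<sigma> * (x \<bullet> sgn (\<sigma> *\<^sub>R (p k - a))) = inverse (norm (p k - a)) * (x \<bullet> (p k - a))" for x k
    using \<sigma> by (auto simp: sgn_div_norm norm_minus_commute inner_diff_right algebra_simps)
  have "\<sigma> * (\<mu> \<bullet> u) \<le> 0"
  proof (rule tendsto_upperbound)
    show "(\<lambda>k. \<sigma> * (\<mu> \<bullet> sgn (\<sigma> *\<^sub>R (p k - a)))) \<longlonglongrightarrow> \<sigma> * (\<mu> \<bullet> u)" by (intro tendsto_intros u)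
    show "\<forall>\<^sub>F k in sequentially. \<sigma> * (\<mu> \<bullet> sgn (\<sigma> *\<^sub>R (p k - a))) \<le> 0"
      unfolding s using \<mu> p by (intro always_eventually allI mult_nonneg_nonpos) (auto simp: unit_normals_def)
  qed auto
  moreover have "\<sigma> * (\<mu> \<bullet> u) \<ge> 0"
  proof (rule tendsto_lowerbound)
    show "(\<lambda>k. \<sigma> * (\<nu> k \<bullet> sgn (\<sigma> *\<^sub>R (p k - a)))) \<longlonglongrightarrow> \<sigma> * (\<mu> \<bullet> u)"
      by (intro tendsto_intros u \<nu>)
    have "\<nu> k \<bullet> (p k - a) \<ge> 0" for k
    proof -
      have "\<nu> k \<bullet> (a - p k) \<le> 0" using \<nu>(1)[of k] a by (simp add: unit_normals_def)
      then show ?thesis by (simp add: inner_diff_right)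
    qed
    then show "\<forall>\<^sub>F k in sequentially. \<sigma> * (\<nu> k \<bullet> sgn (\<sigma> *\<^sub>R (p k - a))) \<ge> 0"
      unfolding s by (intro always_eventually allI mult_nonneg_nonneg) auto
  qed auto
  ultimately show "\<mu> \<bullet> u = 0" using \<sigma> by auto
qed

text \<open>Orthogonality makes \<open>\<nu>\<close> a multiple of \<open>quarter_turn u\<close>,
  and the interior point \<open>z\<close> decides the sign of the factor.\<close>

lemma unit_normal_orthogonal:
  assumes "\<nu> \<in> unit_normals K a" "norm u = 1" "\<nu> \<bullet> u = 0" "z \<in> interior K" "cross2 u (z - a) \<ge> 0"
  obtains c where "c < 0" "\<And>x. \<nu> \<bullet> x = c * cross2 u x"
proof -
  obtain c where c: "\<nu> = c *\<^sub>R quarter_turn u"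
    using orthogonal_unit_vector assms(2,3) by blast
  then have eq: "\<nu> \<bullet> x = c * cross2 u x" for x
    by (simp add: cross2_eq_inner)
  then have "c < 0"
    using unit_normal_interior[OF assms(1,4)] assms(5) by (auto simp: mult_less_0_iff)
  with eq that show ?thesis by blast
qed

section \<open>Uniqueness and existence of the one-sided tangents\<close>

lemma tangent_direction_interior:
  assumes "tangent_direction \<sigma> K a u" "z \<in> interior K"
  shows "cross2 u (z - a) > 0"
proof -
  have "- quarter_turn u \<in> unit_normals K a"
    using assms(1) by (simp add: tangent_direction_def unit_normals_def cross2_eq_inner)
  from unit_normal_interior[OF this assms(2)] show ?thesis by (simp add: cross2_eq_inner)
qed

text \<open>The negated quarter turns of \<open>u\<close> and \<open>v\<close> are normals at
  \<open>a\<close>, so each direction is tested against the other. Antisymmetry of the cross product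
  makes the two inequalities an equality, so \<open>u\<close> and \<open>v\<close> are parallel;
  they are not opposite, as interior points lie to the left of both.\<close>

lemma tangent_direction_unique:
  assumes \<sigma>: "\<sigma> = 1 \<or> \<sigma> = -1" and u: "tangent_direction \<sigma> K a u" and v: "tangent_direction \<sigma> K a v"
  shows "u = v"
proof -
  have n: "norm u = 1" "norm v = 1" using u v by (auto simp: tangent_direction_def)
  have "- quarter_turn u \<in> unit_normals K a" "- quarter_turn v \<in> unit_normals K a"
    using u v by (simp_all add: tangent_direction_def unit_normals_def cross2_eq_inner)
  then have "\<sigma> * (- quarter_turn u \<bullet> v) \<le> 0" "\<sigma> * (- quarter_turn v \<bullet> u) \<le> 0"
    using u v by (auto simp: tangent_direction_def)
  then have "quarter_turn u \<bullet> v = 0"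
    using \<sigma> cross2_commute[of u v] by (auto simp: cross2_eq_inner)
  then obtain c where c: "v = c *\<^sub>R quarter_turn (quarter_turn u)"
    using orthogonal_unit_vector[of "quarter_turn u" v] n by (auto simp: inner_commute)
  then have "\<bar>c\<bar> = 1" using n by simp
  moreover have "v \<noteq> - u"
  proof
    assume "v = - u"
    obtain z where "z \<in> interior K" using interior_K by blast
    from tangent_direction_interior[OF u this] tangent_direction_interior[OF v this] \<open>v = - u\<close>
    show False by (simp add: cross2_eq_inner quarter_turn_minus)
  qed
  ultimately show ?thesis
    using c by (cases "c \<ge> 0") auto
qed

text \<open>Normals at the points \<open>p k\<close> have a cluster point \<open>\<mu>\<close>, a
  normal at \<open>a\<close> orthogonal to \<open>u\<close>; hence the line along \<open>u\<close>
  supports \<open>K\<close>. The arc determines on which side \<open>K\<close> lies, and the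
  extremality of \<open>u\<close> follows from \<open>p k\<close> being in \<open>K\<close>.\<close>

lemma boundary_arc_cluster_tangent:
  assumes \<sigma>: "\<sigma> = 1 \<or> \<sigma> = -1" and a: "a \<in> frontier K" and z: "z \<in> interior K"
    and p: "\<And>k. p k \<in> boundary_arc \<sigma> K z a - {a}" and pa: "p \<longlonglongrightarrow> a"
    and u: "(\<lambda>k. sgn (\<sigma> *\<^sub>R (p k - a))) \<longlonglongrightarrow> u"
  shows "tangent_direction \<sigma> K a u"
proof -
  have pf: "p k \<in> frontier K" for k using p by (auto simp: boundary_arc_def)
  have "\<exists>\<nu>. \<forall>k. \<nu> k \<in> unit_normals K (p k)"
    by (meson unit_normal_frontier[OF pf])
  then obtain \<nu> where \<nu>: "\<And>k. \<nu> k \<in> unit_normals K (p k)" by blast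
  then have "\<forall>k. \<nu> k \<in> sphere 0 1" by (simp add: unit_normals_def)
  then obtain \<mu> r where "\<mu> \<in> sphere 0 1" and r: "strict_mono r" "(\<nu> \<circ> r) \<longlonglongrightarrow> \<mu>"
    by (rule seq_compactE[OF compact_imp_seq_compact[OF compact_sphere]])
  have aK: "a \<in> K" and pK: "\<And>k. p k \<in> K" using a pf frontier_subset by auto
  have \<mu>: "\<mu> \<in> unit_normals K a" "\<mu> \<bullet> u = 0"
    using unit_normals_secant_limit[of \<sigma> a "p \<circ> r" u "\<nu> \<circ> r" \<mu>] \<sigma> aK pK \<nu> r
      LIMSEQ_subseq_LIMSEQ[OF pa r(1)] LIMSEQ_subseq_LIMSEQ[OF u r(1)] by (simp_all add: o_def)
  have nu: "norm u = 1"
  proof -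
    have "norm (sgn (\<sigma> *\<^sub>R (p k - a))) = 1" for k using p[of k] \<sigma> by (auto simp: norm_sgn)
    then show ?thesis using tendsto_norm[OF u] by (simp add: LIMSEQ_const_iff)
  qed
  have "cross2 (sgn (\<sigma> *\<^sub>R (p k - a))) (z - a) \<ge> 0" for k
  proof -
    \<comment> \<open>Up to the positive scaling and the sign \<open>\<sigma>\<close>, both cross
      products are twice the signed area of the triangle \<open>z\<close>, \<open>a\<close>,
      \<open>p k\<close>.\<close>
    have "0 \<le> inverse (norm (\<sigma> *\<^sub>R (p k - a))) * (\<sigma> * cross2 (a - z) (p k - z))"
      using p[of k] by (intro mult_nonneg_nonneg[OF inverse_nonnegative_iff_nonnegative[THEN iffD2]])
        (auto simp: boundary_arc_def)
    also have "\<dots> = cross2 (sgn (\<sigma> *\<^sub>R (p k - a))) (z - a)"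
      by (simp add: sgn_div_norm cross2_def algebra_simps)
    finally show ?thesis .
  qed
  then have "cross2 u (z - a) \<ge> 0"
    by (intro tendsto_lowerbound[OF tendsto_cross2[OF u tendsto_const]]) auto
  from unit_normal_orthogonal[OF \<mu>(1) nu \<mu>(2) z this]
  obtain c where c: "c < 0" "\<And>x. \<mu> \<bullet> x = c * cross2 u x" by blast
  have "cross2 u (x - a) \<ge> 0" if "x \<in> K" for x
    using \<mu>(1) that c by (fastforce simp: unit_normals_def mult_le_0_iff)
  moreover have "\<sigma> * (\<eta> \<bullet> u) \<le> 0" if "\<eta> \<in> unit_normals K a" for \<eta>
  proof (rule tendsto_upperbound)
    show "(\<lambda>k. \<sigma> * (\<eta> \<bullet> sgn (\<sigma> *\<^sub>R (p k - a)))) \<longlonglongrightarrow> \<sigma> * (\<eta> \<bullet> u)" by (intro tendsto_intros u)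
    have "\<sigma> * (\<eta> \<bullet> sgn (\<sigma> *\<^sub>R (p k - a))) = inverse (norm (p k - a)) * (\<eta> \<bullet> (p k - a))" for k
      using \<sigma> by (auto simp: sgn_div_norm norm_minus_commute inner_diff_right algebra_simps)
    then show "\<forall>\<^sub>F k in sequentially. \<sigma> * (\<eta> \<bullet> sgn (\<sigma> *\<^sub>R (p k - a))) \<le> 0"
      using that pK by (auto simp: unit_normals_def mult_nonneg_nonpos)
  qed auto
  ultimately show ?thesis using nu by (auto simp: tangent_direction_def)
qed

text \<open>The part \<open>S\<close> of a small disc about \<open>a\<close> that lies on the side
  of the arc is convex and contains points inside and outside \<open>K\<close>, so it meets the
  boundary.\<close>

lemma islimpt_boundary_arc:
  assumes \<sigma>: "\<sigma> = 1 \<or> \<sigma> = -1" and a: "a \<in> frontier K" and z: "z \<in> interior K"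
  shows "a islimpt boundary_arc \<sigma> K z a"
  unfolding islimpt_approachable
proof (intro allI impI)
  fix e :: real assume e: "e > 0"
  have aK: "a \<in> K" and az: "a \<noteq> z"
    using a z frontier_subset frontier_notin_interior by auto
  define d where "d = \<sigma> *\<^sub>R quarter_turn (a - z)"
  define S where "S = ball a e \<inter> {x. d \<bullet> x > d \<bullet> z}"
  have S: "x \<in> S \<longleftrightarrow> dist x a < e \<and> \<sigma> * cross2 (a - z) (x - z) > 0" for x
    by (auto simp: S_def d_def cross2_eq_inner inner_diff_right right_diff_distrib dist_commute)
  \<comment> \<open>Points of the line through \<open>z\<close> and \<open>a\<close> lie only on the
    border of the half-plane; a small shift along \<open>d\<close> brings them into \<open>S\<close>
    without leaving the open set \<open>U\<close>.\<close>
  have push: "\<exists>x\<in>S. x \<in> U" if "open U" "a + s *\<^sub>R (a - z) \<in> U" "\<bar>s\<bar> * norm (a - z) < e" for U s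
  proof -
    let ?x = "a + s *\<^sub>R (a - z)"
    have "((\<lambda>t. ?x + t *\<^sub>R d) \<longlongrightarrow> ?x + 0 *\<^sub>R d) (at_right 0)" by (intro tendsto_intros)
    moreover have "open (U \<inter> ball a e)" "?x + 0 *\<^sub>R d \<in> U \<inter> ball a e"
      using that by (auto simp: dist_norm)
    ultimately have "\<forall>\<^sub>F t in at_right 0. ?x + t *\<^sub>R d \<in> U \<inter> ball a e"
      using topological_tendstoD by blast
    then have "\<forall>\<^sub>F t in at_right 0. ?x + t *\<^sub>R d \<in> U \<inter> ball a e \<and> t > 0"
      using eventually_at_right_less[of "0::real"] by (rule eventually_conj)
    then obtain t where t: "?x + t *\<^sub>R d \<in> U \<inter> ball a e" "t > 0"
      using eventually_happens by fastforce
    have x: "?x + t *\<^sub>R d - z = (1 + s) *\<^sub>R (a - z) + t *\<^sub>R d" by (simp add: algebra_simps)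
    have "\<sigma> * cross2 (a - z) (?x + t *\<^sub>R d - z) = t * (norm (a - z))\<^sup>2"
      unfolding x using \<sigma> cross2_self[of "a - z", unfolded cross2_eq_inner]
      by (auto simp: d_def cross2_eq_inner inner_add_right power2_norm_eq_inner)
    then show ?thesis using t az by (intro bexI[of _ "?x + t *\<^sub>R d"]) (auto simp: S dist_commute)
  qed
  obtain s where s: "0 < s" "s \<le> 1" "s * norm (a - z) < e"
  proof
    show "min 1 (e / (2 * norm (a - z))) * norm (a - z) < e"
      using az e by (auto simp: min_def field_simps)
  qed (use az e in auto)
  have "a - s *\<^sub>R (a - z) \<in> interior K"
    using mem_interior_convex_shrink[OF convex_K z aK] s by blast
  then have "\<exists>x\<in>S. x \<in> interior K"
    using push[of "interior K" "- s"] s by auto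
  moreover have "\<exists>x\<in>S. x \<in> - K"
  proof (rule push)
    show "open (- K)" using compact_K compact_imp_closed by auto
    show "a + s *\<^sub>R (a - z) \<in> - K"
    proof
      assume x: "a + s *\<^sub>R (a - z) \<in> K"
      \<comment> \<open>The ratio s / (1 + s) is the one for which shrinking towards
        \<open>z\<close> lands exactly on \<open>a\<close>, which would thus be interior.\<close>
      have "a + s *\<^sub>R (a - z) - (s / (1 + s)) *\<^sub>R (a + s *\<^sub>R (a - z) - z) \<in> interior K"
        using s by (intro mem_interior_convex_shrink[OF convex_K z x]) auto
      also have "a + s *\<^sub>R (a - z) - z = (1 + s) *\<^sub>R (a - z)" by (simp add: algebra_simps)
      also have "a + s *\<^sub>R (a - z) - (s / (1 + s)) *\<^sub>R (1 + s) *\<^sub>R (a - z) = a" using s by simp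
      finally show False using frontier_notin_interior[OF a] by simp
    qed
  qed (use s in simp)
  moreover have "connected S"
    unfolding S_def by (intro convex_connected convex_Int convex_ball) (simp add: convex_halfspace_gt)
  ultimately have "S \<inter> frontier K \<noteq> {}"
    using connected_Int_frontier[of S K] interior_subset[of K] by blast
  then obtain p where p: "p \<in> S" "p \<in> frontier K" by blast
  moreover have "p \<noteq> a" using p(1) by (auto simp: S)
  ultimately show "\<exists>p\<in>boundary_arc \<sigma> K z a. p \<noteq> a \<and> dist p a < e"
    by (auto simp: S boundary_arc_def)
qed

text \<open>Every subsequential limit of secant directions is a tangent direction, and there is only
  one of these.\<close>

lemma boundary_arc_tendsto:
  assumes \<sigma>: "\<sigma> = 1 \<or> \<sigma> = -1" and a: "a \<in> frontier K" and z: "z \<in> interior K"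
    and u: "tangent_direction \<sigma> K a u"
  shows "((\<lambda>p. sgn (\<sigma> *\<^sub>R (p - a))) \<longlongrightarrow> u) (at a within boundary_arc \<sigma> K z a)"
  unfolding tendsto_at_iff_sequentially
proof (intro allI impI)
  fix p assume p: "\<forall>i. p i \<in> boundary_arc \<sigma> K z a - {a}" "p \<longlonglongrightarrow> a"
  show "((\<lambda>p. sgn (\<sigma> *\<^sub>R (p - a))) \<circ> p) \<longlonglongrightarrow> u"
  proof (rule tendsto_if_subseq_limits_eq[OF compact_sphere])
    show "((\<lambda>p. sgn (\<sigma> *\<^sub>R (p - a))) \<circ> p) k \<in> sphere 0 1" for k
      using p(1) \<sigma> by (auto simp: norm_sgn)
    fix r :: "nat \<Rightarrow> nat" and l
    assume r: "strict_mono r" "((\<lambda>p. sgn (\<sigma> *\<^sub>R (p - a))) \<circ> p \<circ> r) \<longlonglongrightarrow> l"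
    have "tangent_direction \<sigma> K a l"
      using r(2) p(1) LIMSEQ_subseq_LIMSEQ[OF p(2) r(1)]
      by (intro boundary_arc_cluster_tangent[OF \<sigma> a z, of "p \<circ> r"]) (auto simp: o_def)
    then show "l = u" using tangent_direction_unique[OF \<sigma>] u by blast
  qed
qed

lemma tangent_direction_exists:
  assumes \<sigma>: "\<sigma> = 1 \<or> \<sigma> = -1" and a: "a \<in> frontier K"
  obtains u where "tangent_direction \<sigma> K a u"
proof -
  obtain z where z: "z \<in> interior K" using interior_K by blast
  obtain p where p: "\<And>k. p k \<in> boundary_arc \<sigma> K z a - {a}" "p \<longlonglongrightarrow> a"
    using islimpt_boundary_arc[OF \<sigma> a z] unfolding islimpt_sequential by blast
  have "\<forall>k. sgn (\<sigma> *\<^sub>R (p k - a)) \<in> sphere 0 1"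
    using p(1) \<sigma> by (auto simp: norm_sgn)
  then obtain u r where "u \<in> sphere 0 1" and r: "strict_mono r" "((\<lambda>k. sgn (\<sigma> *\<^sub>R (p k - a))) \<circ> r) \<longlonglongrightarrow> u"
    by (rule seq_compactE[OF compact_imp_seq_compact[OF compact_sphere]])
  have "tangent_direction \<sigma> K a u"
    using r p(1) LIMSEQ_subseq_LIMSEQ[OF p(2) r(1)]
    by (intro boundary_arc_cluster_tangent[OF \<sigma> a z, of "p \<circ> r"]) (auto simp: o_def)
  then show ?thesis using that by blast
qed

text \<open>The descriptions defining the tangents are meaningful: the limit exists for every
  \<open>z\<close> and is unique, as \<open>a\<close> is a limit point of the arc.\<close>

lemma tangent_direction_The:
  assumes \<sigma>: "\<sigma> = 1 \<or> \<sigma> = -1" and a: "a \<in> frontier K"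
  shows "tangent_direction \<sigma> K a (THE u. \<forall>z\<in>interior K.
    ((\<lambda>p. sgn (\<sigma> *\<^sub>R (p - a))) \<longlongrightarrow> u) (at a within boundary_arc \<sigma> K z a))"
proof -
  obtain u where u: "tangent_direction \<sigma> K a u" using tangent_direction_exists[OF assms] .
  obtain z where z: "z \<in> interior K" using interior_K by blast
  have "at a within boundary_arc \<sigma> K z a \<noteq> bot"
    using islimpt_boundary_arc[OF \<sigma> a z] by (simp add: trivial_limit_within)
  then have "(THE u. \<forall>z\<in>interior K.
      ((\<lambda>p. sgn (\<sigma> *\<^sub>R (p - a))) \<longlongrightarrow> u) (at a within boundary_arc \<sigma> K z a)) = u"
    using boundary_arc_tendsto[OF \<sigma> a _ u] z tendsto_unique by (intro the_equality) blast+
  then show ?thesis using u by simp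
qed

lemma left_tangent_direction:
  "a \<in> frontier K \<Longrightarrow> tangent_direction (-1) K a (left_tangent K a)"
  using tangent_direction_The[of "-1" a]
  by (simp add: left_tangent_def boundary_arc_def preceding_arc_def)

lemma right_tangent_direction:
  "a \<in> frontier K \<Longrightarrow> tangent_direction 1 K a (right_tangent K a)"
  using tangent_direction_The[of 1 a]
  by (simp add: right_tangent_def boundary_arc_def following_arc_def)

section \<open>Inward velocities at \<open>a\<close> and at nearby boundary points\<close>

lemma tangent_sequence:
  assumes \<sigma>: "\<sigma> = 1 \<or> \<sigma> = -1" and a: "a \<in> frontier K" and u: "tangent_direction \<sigma> K a u"
  obtains p where "\<And>k. p k \<in> frontier K" "p \<longlonglongrightarrow> a" "(\<lambda>k. sgn (\<sigma> *\<^sub>R (p k - a))) \<longlonglongrightarrow> u"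
proof -
  obtain z where z: "z \<in> interior K" using interior_K by blast
  obtain p where p: "\<And>k. p k \<in> boundary_arc \<sigma> K z a - {a}" "p \<longlonglongrightarrow> a"
    using islimpt_boundary_arc[OF \<sigma> a z] unfolding islimpt_sequential by blast
  have "(\<lambda>k. sgn (\<sigma> *\<^sub>R (p k - a))) \<longlonglongrightarrow> u"
    using boundary_arc_tendsto[OF \<sigma> a z u] p unfolding tendsto_at_iff_sequentially by (auto simp: o_def)
  then show ?thesis using that[of p] p by (auto simp: boundary_arc_def)
qed

text \<open>Otherwise infinitely many \<open>p k\<close> have a normal not opposing
  \<open>v k\<close>. A limit of these normals is a negative multiple of
  \<open>quarter_turn u\<close>, which does oppose \<open>w\<close>. So near \<open>a\<close> on one
  side, a single tangent decides.\<close>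

lemma eventually_inward_at_sequence:
  assumes \<sigma>: "\<sigma> = 1 \<or> \<sigma> = -1" and a: "a \<in> frontier K" and u: "tangent_direction \<sigma> K a u"
    and p: "\<And>k. p k \<in> frontier K" "p \<longlonglongrightarrow> a" "(\<lambda>k. sgn (\<sigma> *\<^sub>R (p k - a))) \<longlonglongrightarrow> u"
    and w: "v \<longlonglongrightarrow> w" "cross2 u w > 0"
  shows "\<forall>\<^sub>F k in sequentially. v k \<in> inward_directions K (p k)"
proof (rule ccontr)
  assume "\<not> ?thesis"
  then have "infinite {k. v k \<notin> inward_directions K (p k)}"
    by (simp add: infinite_nat_iff_unbounded_le eventually_sequentially)
  then obtain r :: "nat \<Rightarrow> nat" where r: "strict_mono r" "\<And>k. v (r k) \<notin> inward_directions K (p (r k))"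
    using infinite_enumerate by blast
  have "\<exists>\<nu>. \<nu> \<in> unit_normals K (p (r k)) \<and> \<nu> \<bullet> v (r k) \<ge> 0" for k
    by (rule unit_normal_if_not_inward[OF subsetD[OF frontier_subset p(1)] r(2)]) blast
  then obtain \<nu> where \<nu>: "\<And>k. \<nu> k \<in> unit_normals K (p (r k))" "\<And>k. \<nu> k \<bullet> v (r k) \<ge> 0"
    by metis
  then have "\<forall>k. \<nu> k \<in> sphere 0 1" by (simp add: unit_normals_def)
  then obtain \<mu> s where "\<mu> \<in> sphere 0 1" and s: "strict_mono s" "(\<nu> \<circ> s) \<longlonglongrightarrow> \<mu>"
    by (rule seq_compactE[OF compact_imp_seq_compact[OF compact_sphere]])
  have rs: "strict_mono (r \<circ> s)" using r s by (simp add: strict_mono_o)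
  have \<mu>: "\<mu> \<in> unit_normals K a" "\<mu> \<bullet> u = 0"
    using unit_normals_secant_limit[of \<sigma> a "p \<circ> (r \<circ> s)" u "\<nu> \<circ> s" \<mu>] \<sigma> a p(1) frontier_subset \<nu>(1) s
      LIMSEQ_subseq_LIMSEQ[OF p(2) rs] LIMSEQ_subseq_LIMSEQ[OF p(3) rs] by (auto simp: o_def)
  obtain z where z: "z \<in> interior K" using interior_K by blast
  obtain c where c: "c < 0" "\<And>x. \<mu> \<bullet> x = c * cross2 u x"
    using unit_normal_orthogonal[OF \<mu>(1) _ \<mu>(2) z] tangent_direction_interior[OF u z] u
    by (auto simp: tangent_direction_def)
  have "\<mu> \<bullet> w \<ge> 0"
  proof (rule tendsto_lowerbound)
    show "(\<lambda>k. (\<nu> \<circ> s) k \<bullet> (v \<circ> (r \<circ> s)) k) \<longlonglongrightarrow> \<mu> \<bullet> w"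
      by (intro tendsto_intros s LIMSEQ_subseq_LIMSEQ[OF w(1) rs])
  qed (use \<nu>(2) in auto)
  then show False using c w(2) by (simp add: zero_le_mult_iff)
qed

text \<open>A normal \<open>\<nu>\<close> not opposing \<open>w\<close> would have nonzero inner
  products of the same sign with both tangents, whereas the extremality of the tangents gives them
  opposite weak signs.\<close>

lemma inward_if_inward_both_tangents:
  assumes a: "a \<in> frontier K" and w: "cross2 (left_tangent K a) w > 0" "cross2 (right_tangent K a) w > 0"
  shows "w \<in> inward_directions K a"
proof (rule ccontr)
  assume "w \<notin> inward_directions K a"
  then obtain \<nu> where \<nu>: "\<nu> \<in> unit_normals K a" "\<nu> \<bullet> w \<ge> 0"
    using unit_normal_if_not_inward a frontier_subset by blast
  obtain z where z: "z \<in> interior K" using interior_K by blast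
  note n = unit_normal_interior[OF \<nu>(1) z]
  have "cross2 w (z - a) * (\<nu> \<bullet> u) > 0"
    if "tangent_direction \<sigma> K a u" "cross2 u w > 0" for \<sigma> u
  proof -
    \<comment> \<open>This is the linear relation between the three plane vectors \<open>u\<close>,
      \<open>w\<close> and \<open>z - a\<close>, paired with \<open>\<nu>\<close>.\<close>
    have "cross2 w (z - a) * (\<nu> \<bullet> u) = cross2 u (z - a) * (\<nu> \<bullet> w) - cross2 u w * (\<nu> \<bullet> (z - a))"
      by (simp add: cross2_def inner_2 algebra_simps)
    moreover have "cross2 u (z - a) * (\<nu> \<bullet> w) \<ge> 0"
      using tangent_direction_interior[OF that(1) z] \<nu>(2) by simp
    moreover have "cross2 u w * (\<nu> \<bullet> (z - a)) < 0"
      using that(2) n by (simp add: mult_pos_neg)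
    ultimately show ?thesis by linarith
  qed
  note this[OF left_tangent_direction[OF a] w(1)] this[OF right_tangent_direction[OF a] w(2)]
  moreover have "\<nu> \<bullet> left_tangent K a \<ge> 0" "\<nu> \<bullet> right_tangent K a \<le> 0"
    using left_tangent_direction[OF a] right_tangent_direction[OF a] \<nu>(1)
    by (auto simp: tangent_direction_def)
  ultimately show False by (auto simp: zero_less_mult_iff)
qed

section \<open>Fixing\<close>

lemma interior_on_ray:
  assumes "b \<in> K" "b + t *\<^sub>R w \<in> interior K" "0 < e" "e \<le> t"
  shows "b + e *\<^sub>R w \<in> interior K"
proof -
  have "b - (e / t) *\<^sub>R (b - (b + t *\<^sub>R w)) \<in> interior K"
    using assms by (intro mem_interior_convex_shrink[OF convex_K]) auto
  then show ?thesis using assms by simp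
qed

text \<open>The quarter turn of \<open>z - a\<close>, for an interior point \<open>z\<close>, points
  strictly into the sector and serves as the direction of perturbation.\<close>

lemma mem_closure_left_sector:
  assumes a: "a \<in> frontier K" and x: "left_tangent K a \<bullet> (x - a) \<le> 0" "right_tangent K a \<bullet> (x - a) \<le> 0"
  shows "x \<in> closure (left_sector K a)"
proof -
  obtain z where z: "z \<in> interior K" using interior_K by blast
  have "u \<bullet> quarter_turn (z - a) < 0" if "tangent_direction \<sigma> K a u" for \<sigma> u
    using tangent_direction_interior[OF that z] by (simp add: inner_quarter_turn_right)
  then show ?thesis
    unfolding left_sector_eq
    using mem_closure_open_sector x left_tangent_direction[OF a] right_tangent_direction[OF a] by blast
qed

lemma mem_closure_right_sector:
  assumes a: "a \<in> frontier K" and x: "left_tangent K a \<bullet> (x - a) \<ge> 0" "right_tangent K a \<bullet> (x - a) \<ge> 0"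
  shows "x \<in> closure (right_sector K a)"
proof -
  obtain z where z: "z \<in> interior K" using interior_K by blast
  have "- u \<bullet> - quarter_turn (z - a) < 0" if "tangent_direction \<sigma> K a u" for \<sigma> u
    using tangent_direction_interior[OF that z] by (simp add: inner_quarter_turn_right)
  note this[OF left_tangent_direction[OF a]] this[OF right_tangent_direction[OF a]]
  from mem_closure_open_sector[OF this, of x a] x show ?thesis
    by (simp add: right_sector_eq)
qed

text \<open>The pair \<open>(\<omega>, \<tau>)\<close> arises as a limit of normalised displacements \<open>f\<inverse> - id\<close>.\<close>

lemma fixes_body_if_inward:
  assumes B: "finite B" "B \<subseteq> frontier K"
    and inward: "\<And>\<omega> \<tau>. norm (\<omega> :: real, \<tau>) = 1 \<Longrightarrow>
      \<exists>b\<in>B. \<omega> *\<^sub>R quarter_turn b + \<tau> \<in> inward_directions K b"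
  shows "fixes_body K B"
proof (rule ccontr)
  assume contr: "\<not> fixes_body K B"
  define e1 :: "real^2" where "e1 = axis 1 1"
  have "\<exists>c s v. c\<^sup>2 + s\<^sup>2 = 1 \<and> \<bar>c - 1\<bar> < e \<and> \<bar>s\<bar> < e \<and> norm v < e \<and> (c, s, v) \<noteq> (1, 0, 0) \<and>
      (\<forall>b\<in>B. c *\<^sub>R (b - v) - s *\<^sub>R quarter_turn (b - v) \<notin> interior K)" if "e > 0" for e :: real
  proof -
    \<comment> \<open>The values at 0 and at \<open>e1\<close> suffice to control an isometry: they
      determine \<open>v\<close>, and \<open>f e1 - f 0 - e1\<close> has the components
      \<open>c - 1\<close> and \<open>s\<close>.\<close>
    define T where "T = {f :: real^2 \<Rightarrow> real^2. norm (f 0) < e \<and> norm (f e1 - f 0 - e1) < e}"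
    have "open T"
      unfolding T_def
      by (intro open_Collect_conj open_Collect_less continuous_intros continuous_on_product_coordinates)
    then have "openin (top_of_set isom_plus) (isom_plus \<inter> T)" by (simp add: openin_open_Int)
    moreover have "id \<in> isom_plus \<inter> T"
      using that rotation_about_isom_plus[of 0 0] by (simp add: rotation_about_zero T_def)
    ultimately have "\<exists>f\<in>isom_plus \<inter> T. f ` K \<noteq> K \<and> \<not> (\<exists>b\<in>B. b \<in> interior (f ` K))"
      using contr B unfolding fixes_body_def by metis
    then obtain f where f: "f \<in> isom_plus" "f \<in> T" "f ` K \<noteq> K" "\<And>b. b \<in> B \<Longrightarrow> b \<notin> interior (f ` K)"
      by auto
    obtain c s v where cs: "c\<^sup>2 + s\<^sup>2 = 1" and f_eq: "f = (\<lambda>x. c *\<^sub>R x + s *\<^sub>R quarter_turn x + v)"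
      using f(1) unfolding isom_plus_iff by blast
    have "f e1 - f 0 - e1 = (c - 1) *\<^sub>R e1 + s *\<^sub>R quarter_turn e1"
      by (simp add: f_eq algebra_simps linear_0[OF linear_quarter_turn])
    then have comp: "(f e1 - f 0 - e1) $ 1 = c - 1" "(f e1 - f 0 - e1) $ 2 = s"
      by (simp_all add: e1_def axis_def)
    have "norm (f e1 - f 0 - e1) < e" using f(2) by (simp add: T_def)
    then have "\<bar>c - 1\<bar> < e" "\<bar>s\<bar> < e"
      unfolding comp[symmetric] by (rule le_less_trans[OF component_le_norm_cart])+
    moreover have "norm v < e"
      using f(2) by (simp add: T_def f_eq linear_0[OF linear_quarter_turn])
    moreover have "(c, s, v) \<noteq> (1, 0, 0)" using f(3) by (auto simp: f_eq)
    moreover have "c *\<^sub>R (b - v) - s *\<^sub>R quarter_turn (b - v) \<notin> interior K" if "b \<in> B" for b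
    proof -
      have cc: "c * c + s * s = 1" using cs by (simp add: power2_eq_square)
      have "b \<in> interior (f ` K) \<longleftrightarrow> c *\<^sub>R (b - v) - s *\<^sub>R quarter_turn (b - v) \<in> interior K"
      proof (rule mem_interior_image_iff)
        show "continuous_on UNIV f" "continuous_on UNIV (\<lambda>x. c *\<^sub>R (x - v) - s *\<^sub>R quarter_turn (x - v))"
          unfolding f_eq by (intro continuous_intros)+
        show "f (c *\<^sub>R (x - v) - s *\<^sub>R quarter_turn (x - v)) = x" for x
        proof -
          have "f (c *\<^sub>R (x - v) - s *\<^sub>R quarter_turn (x - v)) = (c * c + s * s) *\<^sub>R (x - v) + v"
            by (simp add: f_eq quarter_turn_add quarter_turn_diff quarter_turn_scaleR algebra_simps)
          then show ?thesis by (simp add: cc)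
        qed
        show "c *\<^sub>R (f x - v) - s *\<^sub>R quarter_turn (f x - v) = x" for x
        proof -
          have "c *\<^sub>R (f x - v) - s *\<^sub>R quarter_turn (f x - v) = (c * c + s * s) *\<^sub>R x"
            by (simp add: f_eq quarter_turn_add quarter_turn_diff quarter_turn_scaleR algebra_simps)
          then show ?thesis by (simp add: cc)
        qed
      qed
      then show ?thesis using f(4)[OF that] by simp
    qed
    ultimately show ?thesis using cs by blast
  qed
  then have "\<exists>c s v. c\<^sup>2 + s\<^sup>2 = 1 \<and> \<bar>c - 1\<bar> < inverse (real (Suc k)) \<and> \<bar>s\<bar> < inverse (real (Suc k)) \<and>
      norm v < inverse (real (Suc k)) \<and> (c, s, v) \<noteq> (1, 0, 0) \<and>
      (\<forall>b\<in>B. c *\<^sub>R (b - v) - s *\<^sub>R quarter_turn (b - v) \<notin> interior K)" for k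
    by simp
  then obtain c s v where cs: "\<And>k. (c k)\<^sup>2 + (s k)\<^sup>2 = 1"
    and small: "\<And>k. \<bar>c k - 1\<bar> < inverse (real (Suc k))" "\<And>k. \<bar>s k\<bar> < inverse (real (Suc k))"
      "\<And>k. norm (v k) < inverse (real (Suc k))"
    and nontrivial: "\<And>k. (c k, s k, v k) \<noteq> (1, 0, 0)"
    and outside: "\<And>k b. b \<in> B \<Longrightarrow> c k *\<^sub>R (b - v k) - s k *\<^sub>R quarter_turn (b - v k) \<notin> interior K"
    by metis
  \<comment> \<open>Positivity excludes the half turn \<open>c = -1\<close> when
    \<open>s = 0\<close>, and it gives \<open>1 + c k \<ge> 1\<close> for the estimate of
    \<open>c k - 1\<close>.\<close>
  have c_pos: "c k > 0" for k
  proof -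
    have "inverse (real (Suc k)) \<le> 1" by (simp add: inverse_le_1_iff)
    then show ?thesis using small(1)[of k] by linarith
  qed
  \<comment> \<open>The inverse isometry displaces \<open>b\<close> by
    \<open>(c k - 1) *\<^sub>R b - s k *\<^sub>R quarter_turn b + t k\<close>; \<open>N k\<close>
    measures the size of the last two coefficients.\<close>
  define t where "t k = s k *\<^sub>R quarter_turn (v k) - c k *\<^sub>R v k" for k
  define N where "N k = norm (- s k, t k)" for k
  have s_le: "\<bar>s k\<bar> \<le> N k" for k
    using norm_fst_le[of "- s k" "t k"] by (simp add: N_def)
  have norm_t: "norm (t k) = norm (v k)" for k
  proof -
    have "(norm (t k))\<^sup>2 = ((c k)\<^sup>2 + (s k)\<^sup>2) * (norm (v k))\<^sup>2"
      unfolding power2_norm_eq_inner by (simp add: t_def inner_2 power2_eq_square algebra_simps)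
    then show ?thesis by (simp add: cs)
  qed
  have N_pos: "N k > 0" for k
  proof (rule ccontr)
    assume "\<not> N k > 0"
    then have "s k = 0" "v k = 0" using norm_t[of k] by (auto simp: N_def zero_prod_def)
    moreover from this have "c k = 1" using cs[of k] c_pos[of k] by (simp add: power2_eq_1_iff)
    ultimately show False using nontrivial by blast
  qed
  have lim0: "(\<lambda>k. inverse (real (Suc k))) \<longlonglongrightarrow> 0" by (rule LIMSEQ_inverse_real_of_nat)
  have s0: "s \<longlonglongrightarrow> 0"
    by (rule Lim_null_comparison[OF _ lim0]) (simp add: less_imp_le[OF small(2)] del: of_nat_Suc)
  have t0: "t \<longlonglongrightarrow> 0"
    by (rule Lim_null_comparison[OF _ lim0]) (simp add: norm_t less_imp_le[OF small(3)] del: of_nat_Suc)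
  have N0: "N \<longlonglongrightarrow> 0"
  proof -
    have "(\<lambda>k. norm (- s k, t k)) \<longlonglongrightarrow> norm (- 0 :: real, 0 :: real^2)" by (intro tendsto_intros s0 t0)
    then show ?thesis by (simp add: N_def[abs_def])
  qed
  \<comment> \<open>As \<open>(c - 1) * (1 + c) = - s\<^sup>2\<close>, the term \<open>c - 1\<close>
    is of second order and vanishes in the limit after normalisation.\<close>
  have c0: "(\<lambda>k. (c k - 1) / N k) \<longlonglongrightarrow> 0"
  proof (rule Lim_null_comparison)
    show "(\<lambda>k. \<bar>s k\<bar>) \<longlonglongrightarrow> 0" using s0 by (simp add: tendsto_rabs_zero)
    have "\<bar>(c k - 1) / N k\<bar> \<le> \<bar>s k\<bar>" for k
    proof -
      have "\<bar>c k - 1\<bar> * 1 \<le> \<bar>c k - 1\<bar> * (1 + c k)"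
        using c_pos[of k] by (intro mult_left_mono) auto
      also have "\<dots> = \<bar>(c k - 1) * (1 + c k)\<bar>" using c_pos[of k] by (simp add: abs_mult)
      also have "(c k - 1) * (1 + c k) = - (s k * s k)"
        using cs[of k] by (simp add: power2_eq_square algebra_simps)
      also have "\<bar>- (s k * s k)\<bar> = \<bar>s k\<bar> * \<bar>s k\<bar>" by simp
      also have "\<dots> \<le> \<bar>s k\<bar> * N k" by (intro mult_left_mono s_le) simp
      finally show ?thesis using N_pos[of k] by (simp add: divide_le_eq)
    qed
    then show "\<forall>\<^sub>F k in sequentially. norm ((c k - 1) / N k) \<le> \<bar>s k\<bar>" by simp
  qed
  define x where "x k = inverse (N k) *\<^sub>R (- s k, t k)" for k
  have "norm (x k) = 1" for k
  proof -
    have "norm (x k) = \<bar>inverse (N k)\<bar> * N k" unfolding x_def norm_scaleR N_def ..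
    then show ?thesis using N_pos[of k] by simp
  qed
  then have "\<forall>k. x k \<in> sphere 0 1" by simp
  then obtain l r where "l \<in> sphere 0 1" and r: "strict_mono r" "(x \<circ> r) \<longlonglongrightarrow> l"
    by (rule seq_compactE[OF compact_imp_seq_compact[OF compact_sphere]])
  then obtain b where b: "b \<in> B" "fst l *\<^sub>R quarter_turn b + snd l \<in> inward_directions K b"
    using inward[of "fst l" "snd l"] by auto
  have bK: "b \<in> K" using b(1) B(2) frontier_subset by blast
  \<comment> \<open>This is the displacement of \<open>b\<close> under the inverse isometry, divided
    by \<open>N k\<close>.\<close>
  define w where "w k = ((c k - 1) / N k) *\<^sub>R b + fst (x k) *\<^sub>R quarter_turn b + snd (x k)" for k
  obtain e where e: "e > 0" "b + e *\<^sub>R (fst l *\<^sub>R quarter_turn b + snd l) \<in> interior K"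
    using b(2) by (auto simp: inward_directions_def)
  \<comment> \<open>With the step \<open>e\<close> fixed, \<open>b + e *\<^sub>R w (r k)\<close> is
    eventually interior. Once \<open>N (r k) < e\<close>, convexity makes the shorter step interior
    as well, and that step leads to the inverse image of \<open>b\<close>.\<close>
  have "(\<lambda>k. b + e *\<^sub>R w (r k)) \<longlonglongrightarrow> b + e *\<^sub>R (0 *\<^sub>R b + fst l *\<^sub>R quarter_turn b + snd l)"
    unfolding w_def using r(2) LIMSEQ_subseq_LIMSEQ[OF c0 r(1)]
    by (intro tendsto_intros) (auto simp: o_def)
  then have "\<forall>\<^sub>F k in sequentially. b + e *\<^sub>R w (r k) \<in> interior K"
    using e(2) by (intro topological_tendstoD) auto
  moreover have "\<forall>\<^sub>F k in sequentially. N (r k) < e"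
    using order_tendstoD(2)[OF LIMSEQ_subseq_LIMSEQ[OF N0 r(1)] e(1)] by simp
  ultimately have "\<forall>\<^sub>F k in sequentially. False"
  proof eventually_elim
    case (elim k)
    have "b + N (r k) *\<^sub>R w (r k) \<in> interior K"
      using interior_on_ray[OF bK elim(1)] N_pos elim(2) by simp
    also have "N (r k) *\<^sub>R w (r k) = (N (r k) * ((c (r k) - 1) / N (r k))) *\<^sub>R b +
        ((N (r k) * inverse (N (r k))) * - s (r k)) *\<^sub>R quarter_turn b + (N (r k) * inverse (N (r k))) *\<^sub>R t (r k)"
      by (simp only: w_def x_def fst_scaleR snd_scaleR fst_conv snd_conv scaleR_add_right scaleR_scaleR
          real_scaleR_def mult.assoc)
    also have "\<dots> = (c (r k) - 1) *\<^sub>R b + (- s (r k)) *\<^sub>R quarter_turn b + t (r k)"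
      using N_pos[of "r k"] by simp
    also have "b + \<dots> = c (r k) *\<^sub>R (b - v (r k)) - s (r k) *\<^sub>R quarter_turn (b - v (r k))"
      by (simp add: t_def quarter_turn_diff algebra_simps)
    finally show False using outside[OF b(1)] by simp
  qed
  then show False by simp
qed

section \<open>Sufficiency of the conditions on the closed sectors\<close>

text \<open>If no tangent sees an inward velocity, the centre of rotation lies in all closed right
  sectors for positive \<open>\<omega>\<close> and in all closed left sectors for negative
  \<open>\<omega>\<close>. For \<open>\<omega> = 0\<close> the role of the centre is played by a
  common direction.\<close>

lemma exists_inward_tangent:
  assumes a: "\<And>i. i \<in> I \<Longrightarrow> a i \<in> frontier K"
    and left: "(\<Inter>i\<in>I. closure (left_sector K (a i))) = {}"
    and right: "(\<Inter>i\<in>I. closure (right_sector K (a i))) = {}"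
    and directions: "(\<Inter>i\<in>I. left_directions K (a i)) = {}"
    and norm: "norm (\<omega> :: real, \<tau>) = 1"
  shows "\<exists>i\<in>I. cross2 (left_tangent K (a i)) (\<omega> *\<^sub>R quarter_turn (a i) + \<tau>) > 0 \<or>
    cross2 (right_tangent K (a i)) (\<omega> *\<^sub>R quarter_turn (a i) + \<tau>) > 0"
proof (rule ccontr)
  assume contr: "\<not> ?thesis"
  show False
  proof (cases "\<omega> = 0")
    case False
    \<comment> \<open>the centre of the infinitesimal rotation\<close>
    define c where "c = inverse \<omega> *\<^sub>R quarter_turn \<tau>"
    have "(- \<omega>) *\<^sub>R quarter_turn c = \<tau>"
      using False by (simp add: c_def quarter_turn_scaleR)
    then have "\<omega> *\<^sub>R quarter_turn b + \<tau> = (- \<omega>) *\<^sub>R quarter_turn (c - b)" for b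
      unfolding quarter_turn_diff scaleR_diff_right by simp
    then have "cross2 u (\<omega> *\<^sub>R quarter_turn b + \<tau>) = - \<omega> * (u \<bullet> (c - b))" for u b
      by (simp add: cross2_eq_inner)
    then have c: "\<omega> * (left_tangent K (a i) \<bullet> (c - a i)) \<ge> 0" "\<omega> * (right_tangent K (a i) \<bullet> (c - a i)) \<ge> 0"
      if "i \<in> I" for i
      using contr that by (auto simp: not_less)
    show False
    proof (cases "\<omega> > 0")
      case True
      then have "c \<in> (\<Inter>i\<in>I. closure (right_sector K (a i)))"
        using c a by (auto intro!: mem_closure_right_sector simp: zero_le_mult_iff)
      then show False using right by simp
    next
      case False
      then have "c \<in> (\<Inter>i\<in>I. closure (left_sector K (a i)))"
        using c a \<open>\<omega> \<noteq> 0\<close> by (auto intro!: mem_closure_left_sector simp: zero_le_mult_iff)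
      then show False using left by simp
    qed
  next
    case True
    \<comment> \<open>The direction \<open>- quarter_turn \<tau>\<close> is the centre at infinity;
      it is a unit vector because \<open>\<omega>\<close> vanishes.\<close>
    have "left_tangent K (a i) \<bullet> - quarter_turn \<tau> \<le> 0" "right_tangent K (a i) \<bullet> - quarter_turn \<tau> \<le> 0"
      if "i \<in> I" for i
      using contr that True by (auto simp: not_less cross2_def inner_2)
    then have "- quarter_turn \<tau> \<in> (\<Inter>i\<in>I. left_directions K (a i))"
      using norm True a by (auto simp: left_directions_def norm_Pair intro!: mem_closure_left_sector)
    then show False using directions by simp
  qed
qed

text \<open>Points \<open>P i k\<close> and \<open>Q i k\<close> approach \<open>a i\<close> from
  its two sides. If they failed to fix \<open>K\<close> for all large \<open>k\<close>, the bad
  velocity fields would have a limit \<open>l\<close>; some tangent at some \<open>a i\<close> sees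
  an inward velocity under \<open>l\<close>, and this persists at the nearby points.\<close>

lemma almost_fixes_body_if_sectors_disjoint:
  assumes a: "\<And>i. i \<in> {1..n} \<Longrightarrow> a i \<in> frontier K"
    and left: "(\<Inter>i\<in>{1..n}. closure (left_sector K (a i))) = {}"
    and right: "(\<Inter>i\<in>{1..n}. closure (right_sector K (a i))) = {}"
    and directions: "(\<Inter>i\<in>{1..n}. left_directions K (a i)) = {}"
  shows "almost_fixes_body K n a"
  unfolding almost_fixes_body_def
proof (intro conjI ballI allI impI a)
  fix V :: "nat \<Rightarrow> (real^2) set" assume V: "\<forall>i\<in>{1..n}. open (V i) \<and> a i \<in> V i"
  have "\<exists>p. (\<forall>k. p k \<in> frontier K) \<and> p \<longlonglongrightarrow> a i \<and>
      (\<lambda>k. sgn ((-1) *\<^sub>R (p k - a i))) \<longlonglongrightarrow> left_tangent K (a i)" if "i \<in> {1..n}" for i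
    by (rule tangent_sequence[OF _ a[OF that] left_tangent_direction[OF a[OF that]]]) auto
  then have "\<exists>P. \<forall>i\<in>{1..n}. (\<forall>k. P i k \<in> frontier K) \<and> P i \<longlonglongrightarrow> a i \<and>
      (\<lambda>k. sgn ((-1) *\<^sub>R (P i k - a i))) \<longlonglongrightarrow> left_tangent K (a i)"
    by (intro bchoice ballI)
  then obtain P where P: "\<And>i k. i \<in> {1..n} \<Longrightarrow> P i k \<in> frontier K" "\<And>i. i \<in> {1..n} \<Longrightarrow> P i \<longlonglongrightarrow> a i"
      "\<And>i. i \<in> {1..n} \<Longrightarrow> (\<lambda>k. sgn ((-1) *\<^sub>R (P i k - a i))) \<longlonglongrightarrow> left_tangent K (a i)"
    by blast
  have "\<exists>p. (\<forall>k. p k \<in> frontier K) \<and> p \<longlonglongrightarrow> a i \<and>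
      (\<lambda>k. sgn (1 *\<^sub>R (p k - a i))) \<longlonglongrightarrow> right_tangent K (a i)" if "i \<in> {1..n}" for i
    by (rule tangent_sequence[OF _ a[OF that] right_tangent_direction[OF a[OF that]]]) auto
  then have "\<exists>P. \<forall>i\<in>{1..n}. (\<forall>k. P i k \<in> frontier K) \<and> P i \<longlonglongrightarrow> a i \<and>
      (\<lambda>k. sgn (1 *\<^sub>R (P i k - a i))) \<longlonglongrightarrow> right_tangent K (a i)"
    by (intro bchoice ballI)
  then obtain Q where Q: "\<And>i k. i \<in> {1..n} \<Longrightarrow> Q i k \<in> frontier K" "\<And>i. i \<in> {1..n} \<Longrightarrow> Q i \<longlonglongrightarrow> a i"
      "\<And>i. i \<in> {1..n} \<Longrightarrow> (\<lambda>k. sgn (1 *\<^sub>R (Q i k - a i))) \<longlonglongrightarrow> right_tangent K (a i)"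
    by blast
  define B where "B k = (\<lambda>i. P i k) ` {1..n} \<union> (\<lambda>i. Q i k) ` {1..n}" for k
  have "\<forall>\<^sub>F k in sequentially. \<forall>i\<in>{1..n}. P i k \<in> V i \<and> Q i k \<in> V i"
    using V
    by (intro eventually_ball_finite ballI eventually_conj topological_tendstoD[OF P(2)] topological_tendstoD[OF Q(2)])
      auto
  then obtain N where N: "\<And>k i. k \<ge> N \<Longrightarrow> i \<in> {1..n} \<Longrightarrow> P i k \<in> V i \<and> Q i k \<in> V i"
    unfolding eventually_sequentially by blast
  have "\<exists>k. fixes_body K (B (k + N))"
  proof (rule ccontr)
    assume contr: "\<nexists>k. fixes_body K (B (k + N))"
    have "\<exists>x :: real \<times> (real^2). norm x = 1 \<and>
        (\<forall>b\<in>B (k + N). fst x *\<^sub>R quarter_turn b + snd x \<notin> inward_directions K b)" for k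
    proof (rule ccontr)
      assume "\<not> ?thesis"
      then have "fixes_body K (B (k + N))"
        using P(1) Q(1) by (intro fixes_body_if_inward) (auto simp: B_def)
      then show False using contr by blast
    qed
    then obtain x :: "nat \<Rightarrow> real \<times> (real^2)" where x: "\<And>k. norm (x k) = 1"
        "\<And>k b. b \<in> B (k + N) \<Longrightarrow> fst (x k) *\<^sub>R quarter_turn b + snd (x k) \<notin> inward_directions K b"
      by metis
    have "\<forall>k. x k \<in> sphere 0 1" using x(1) by simp
    then obtain l r where l: "l \<in> sphere 0 1" and r: "strict_mono r" "(x \<circ> r) \<longlonglongrightarrow> l"
      by (rule seq_compactE[OF compact_imp_seq_compact[OF compact_sphere]])
    \<comment> \<open>The shift by \<open>N\<close> keeps the points of \<open>B\<close> inside the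
      prescribed neighbourhoods.\<close>
    define r' where "r' k = r k + N" for k
    have r': "strict_mono r'" using r(1) by (simp add: r'_def strict_mono_def)
    have "\<not> cross2 u (fst l *\<^sub>R quarter_turn b + snd l) > 0"
      if "\<sigma> = 1 \<or> \<sigma> = -1" "b \<in> frontier K" "tangent_direction \<sigma> K b u" "\<And>k. p k \<in> frontier K"
        "p \<longlonglongrightarrow> b" "(\<lambda>k. sgn (\<sigma> *\<^sub>R (p k - b))) \<longlonglongrightarrow> u" "\<And>k. p k \<in> B k" for \<sigma> u b p
    proof
      assume pos: "cross2 u (fst l *\<^sub>R quarter_turn b + snd l) > 0"
      have lim: "(\<lambda>k. fst (x (r k)) *\<^sub>R quarter_turn (p (r' k)) + snd (x (r k)))
          \<longlonglongrightarrow> fst l *\<^sub>R quarter_turn b + snd l"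
        using r(2) LIMSEQ_subseq_LIMSEQ[OF that(5) r'] by (intro tendsto_intros) (auto simp: o_def)
      have "\<forall>\<^sub>F k in sequentially.
          fst (x (r k)) *\<^sub>R quarter_turn (p (r' k)) + snd (x (r k)) \<in> inward_directions K (p (r' k))"
        using eventually_inward_at_sequence[OF that(1-3), of "p \<circ> r'", OF _ _ _ lim pos]
          LIMSEQ_subseq_LIMSEQ[OF that(5) r'] LIMSEQ_subseq_LIMSEQ[OF that(6) r'] that(4)
        by (simp add: o_def)
      then show False using x(2)[OF that(7)[of "r k + N" for k]] by (simp add: r'_def)
    qed
    note no = this
    obtain i where i: "i \<in> {1..n}"
      "cross2 (left_tangent K (a i)) (fst l *\<^sub>R quarter_turn (a i) + snd l) > 0 \<or>
       cross2 (right_tangent K (a i)) (fst l *\<^sub>R quarter_turn (a i) + snd l) > 0"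
      using exists_inward_tangent[OF a left right directions, of "fst l" "snd l"] l by auto
    have "P i k \<in> B k" "Q i k \<in> B k" for k using i(1) by (auto simp: B_def)
    with i(2) no[OF _ a[OF i(1)] left_tangent_direction[OF a[OF i(1)]] P(1-3)[OF i(1)]]
      no[OF _ a[OF i(1)] right_tangent_direction[OF a[OF i(1)]] Q(1-3)[OF i(1)]]
    show False by auto
  qed
  then obtain k where "fixes_body K (B (k + N))" by blast
  then show "\<exists>a' a''. (\<forall>i\<in>{1..n}. a' i \<in> V i \<inter> frontier K \<and> a'' i \<in> V i \<inter> frontier K) \<and>
      fixes_body K (a' ` {1..n} \<union> a'' ` {1..n})"
    using N P(1) Q(1) unfolding B_def
    by (intro exI[of _ "\<lambda>i. P i (k + N)"] exI[of _ "\<lambda>i. Q i (k + N)"]) auto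
qed

section \<open>Necessity of the conditions on the open sectors\<close>

text \<open>The rotation in the sense \<open>s\<close> carries \<open>a\<close> inward, so its
  inverse carries boundary points \<open>b\<close> near \<open>a\<close> out of \<open>K\<close>:
  otherwise \<open>b\<close> would lie between the moved point in \<open>K\<close> and an interior
  point. The neighbourhood does not depend on \<open>q\<close>.\<close>

lemma rotation_moves_boundary_out:
  assumes s: "s = 1 \<or> s = -1" and a: "a \<in> frontier K"
    and tangents: "s * (left_tangent K a \<bullet> (c - a)) < 0" "s * (right_tangent K a \<bullet> (c - a)) < 0"
  shows "\<exists>W. open W \<and> a \<in> W \<and> (\<forall>\<^sub>F q in at_right 0.
    \<forall>b\<in>W \<inter> frontier K. b \<notin> interior (rotation_about (s * q) c ` K))"
proof -
  have ss: "s * s = 1" using s by auto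
  have "s *\<^sub>R quarter_turn (a - c) \<in> inward_directions K a"
    using tangents by (intro inward_if_inward_both_tangents[OF a]) (simp_all add: cross2_def inner_2 algebra_simps)
  then obtain t where t: "t > 0" "a + t *\<^sub>R s *\<^sub>R quarter_turn (a - c) \<in> interior K"
    by (auto simp: inward_directions_def)
  \<comment> \<open>The inverse rotation moves \<open>b\<close> by a positive multiple of
    \<open>v b q\<close>. For \<open>q = 0\<close> and \<open>b = a\<close> the opposite direction
    is inward, and openness extends this to nearby pairs.\<close>
  define v where "v b q = - (q *\<^sub>R (b - c)) - s *\<^sub>R quarter_turn (b - c)" for b q
  have "continuous_on UNIV (\<lambda>x. fst x - t *\<^sub>R v (fst x) (snd x))"
    unfolding v_def by (intro continuous_intros)
  then have "open ((\<lambda>x. fst x - t *\<^sub>R v (fst x) (snd x)) -` interior K)"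
    by (rule open_vimage[OF open_interior])
  moreover have "(a, 0) \<in> (\<lambda>x. fst x - t *\<^sub>R v (fst x) (snd x)) -` interior K"
    using t(2) by (simp add: v_def)
  ultimately obtain W X where W: "open W" "open X" "(a, 0) \<in> W \<times> X"
      "W \<times> X \<subseteq> (\<lambda>x. fst x - t *\<^sub>R v (fst x) (snd x)) -` interior K"
    by (rule open_prod_elim)
  have "\<forall>\<^sub>F q in at_right 0. q \<in> X"
    using W(2,3) by (auto simp: eventually_at_topological)
  then have "\<forall>\<^sub>F q in at_right 0. \<forall>b\<in>W \<inter> frontier K. b \<notin> interior (rotation_about (s * q) c ` K)"
    using eventually_at_right_less[of "0::real"]
  proof eventually_elim
    case (elim q)
    have "b \<notin> interior (rotation_about (s * q) c ` K)" if b: "b \<in> W" "b \<in> frontier K" for b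
    proof
      assume "b \<in> interior (rotation_about (s * q) c ` K)"
      then have in_K: "rotation_about (- (s * q)) c b \<in> K"
        using mem_interior_rotation_about interior_subset by blast
      define e where "e = 2 * q / (1 + q\<^sup>2)"
      have q2: "1 + q\<^sup>2 > 0" by (simp add: add_pos_nonneg)
      have e: "e > 0" using elim(2) q2 by (simp add: e_def)
      have C: "(1 - q\<^sup>2) / (1 + q\<^sup>2) = 1 - e * q"
        using q2 by (simp add: e_def field_simps power2_eq_square)
      have "rotation_about (- (s * q)) c b =
          c + ((1 - q\<^sup>2) / (1 + q\<^sup>2)) *\<^sub>R (b - c) - (s * e) *\<^sub>R quarter_turn (b - c)"
        using ss by (simp add: rotation_about_def power_mult_distrib power2_eq_square[of s] e_def ac_simps)
      also have "\<dots> = b + e *\<^sub>R v b q"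
        unfolding C by (simp add: v_def algebra_simps)
      finally have rot: "rotation_about (- (s * q)) c b = b + e *\<^sub>R v b q" .
      have "b - t *\<^sub>R v b q \<in> interior K" using W(4) b(1) elim(1) by auto
      \<comment> \<open>The ratio e / (e + t) is the one at which the segment from the moved point
        to the interior point passes through \<open>b\<close>.\<close>
      then have "(b + e *\<^sub>R v b q) - (e / (e + t)) *\<^sub>R ((b + e *\<^sub>R v b q) - (b - t *\<^sub>R v b q)) \<in> interior K"
        using in_K e t(1) unfolding rot by (intro mem_interior_convex_shrink[OF convex_K]) auto
      also have "(b + e *\<^sub>R v b q) - (b - t *\<^sub>R v b q) = (e + t) *\<^sub>R v b q" by (simp add: algebra_simps)
      also have "(b + e *\<^sub>R v b q) - (e / (e + t)) *\<^sub>R (e + t) *\<^sub>R v b q = b" using e t(1) by simp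
      finally show False using frontier_notin_interior[OF b(2)] by simp
    qed
    then show ?case by blast
  qed
  then show ?thesis using W(1,3) by auto
qed

text \<open>Rotations by the same angle differ by a translation \<open>d\<close>. If both preserve
  \<open>K\<close>, a point of \<open>K\<close> farthest in the direction \<open>d\<close> is
  shifted farther within \<open>K\<close>.\<close>

lemma rotation_about_two_centres:
  assumes "q \<noteq> 0" "rotation_about q c ` K = K" "rotation_about q c' ` K = K"
  shows "c = c'"
proof (rule ccontr)
  assume "c \<noteq> c'"
  define d where "d = rotation_about q c 0 - rotation_about q c' 0"
  have shift: "rotation_about q c x = rotation_about q c' x + d" for x
    by (simp add: d_def rotation_about_def quarter_turn_diff quarter_turn_minus algebra_simps)
  have q2: "1 + q\<^sup>2 > 0" by (simp add: add_pos_nonneg)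
  have d_eq: "d = (1 - (1 - q\<^sup>2) / (1 + q\<^sup>2)) *\<^sub>R (c - c') - (2 * q / (1 + q\<^sup>2)) *\<^sub>R quarter_turn (c - c')"
    by (simp add: d_def rotation_about_def quarter_turn_diff quarter_turn_minus algebra_simps)
  \<comment> \<open>Pairing with \<open>c - c'\<close> removes the quarter turn; the remaining
    factor, 1 minus the cosine, is positive as \<open>q\<close> is nonzero.\<close>
  have "d \<bullet> (c - c') = (1 - (1 - q\<^sup>2) / (1 + q\<^sup>2)) * ((c - c') \<bullet> (c - c'))"
    unfolding d_eq inner_diff_left[of "_ *\<^sub>R _"] inner_scaleR_left cross2_self[unfolded cross2_eq_inner] by simp
  moreover have "1 - (1 - q\<^sup>2) / (1 + q\<^sup>2) > 0" using q2 assms(1) by (simp add: field_simps)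
  ultimately have d: "d \<noteq> 0" using \<open>c \<noteq> c'\<close> by auto
  have "K \<noteq> {}" using interior_K by auto
  then obtain x where x: "x \<in> K" "\<And>y. y \<in> K \<Longrightarrow> d \<bullet> y \<le> d \<bullet> x"
    using continuous_attains_sup[OF compact_K _ continuous_on_inner[OF continuous_on_const continuous_on_id]] by blast
  obtain y where y: "y \<in> K" "x = rotation_about q c' y" using x(1) assms(3) by blast
  have "x + d \<in> K"
    unfolding y(2) shift[symmetric] using imageI[OF y(1), of "rotation_about q c"] assms(2) by simp
  from x(2)[OF this] have "d \<bullet> d \<le> 0" by (simp add: inner_add_right)
  then show False using d by (metis inner_gt_zero_iff not_le)
qed

text \<open>Almost fixing would force small rotations about every point of \<open>C\<close> to
  preserve \<open>K\<close>, and the open set \<open>C\<close> offers two different centres.\<close>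

lemma not_almost_fixes_body_if_sectors_meet:
  assumes s: "s = 1 \<or> s = -1" and C: "open C" "C \<noteq> {}"
    and sectors: "\<And>c i. c \<in> C \<Longrightarrow> i \<in> {1..n} \<Longrightarrow>
      s * (left_tangent K (a i) \<bullet> (c - a i)) < 0 \<and> s * (right_tangent K (a i) \<bullet> (c - a i)) < 0"
  shows "\<not> almost_fixes_body K n a"
proof
  assume fixing: "almost_fixes_body K n a"
  then have a: "a i \<in> frontier K" if "i \<in> {1..n}" for i
    using that by (simp add: almost_fixes_body_def)
  obtain c where c: "c \<in> C" using C(2) by blast
  moreover have "C \<noteq> {c}" using C(1) not_open_singleton by metis
  ultimately obtain c' where c': "c' \<in> C" "c' \<noteq> c" by blast
  have "\<exists>W. \<forall>i\<in>{1..n}. open (W i) \<and> a i \<in> W i \<and> (\<forall>\<^sub>F q in at_right 0.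
      \<forall>b\<in>W i \<inter> frontier K. b \<notin> interior (rotation_about (s * q) d ` K))" if "d \<in> C" for d
    using rotation_moves_boundary_out[OF s a] sectors[OF that] by (intro bchoice ballI) blast
  from this[OF c] this[OF c'(1)] obtain W W' where
    W: "\<forall>i\<in>{1..n}. open (W i) \<and> a i \<in> W i \<and> (\<forall>\<^sub>F q in at_right 0.
      \<forall>b\<in>W i \<inter> frontier K. b \<notin> interior (rotation_about (s * q) c ` K))" and
    W': "\<forall>i\<in>{1..n}. open (W' i) \<and> a i \<in> W' i \<and> (\<forall>\<^sub>F q in at_right 0.
      \<forall>b\<in>W' i \<inter> frontier K. b \<notin> interior (rotation_about (s * q) c' ` K))"
    by blast
  have "\<forall>i\<in>{1..n}. open (W i \<inter> W' i) \<and> a i \<in> W i \<inter> W' i" using W W' by blast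
  then obtain a' a'' where
    a': "\<And>i. i \<in> {1..n} \<Longrightarrow> a' i \<in> W i \<inter> W' i \<inter> frontier K \<and> a'' i \<in> W i \<inter> W' i \<inter> frontier K"
    and B_fixes: "fixes_body K (a' ` {1..n} \<union> a'' ` {1..n})"
    using fixing unfolding almost_fixes_body_def by (elim conjE allE[of _ "\<lambda>i. W i \<inter> W' i"]) blast
  obtain V where V: "openin (top_of_set isom_plus) V" "id \<in> V"
      "\<forall>f\<in>V. f ` K \<noteq> K \<longrightarrow> (\<exists>b\<in>a' ` {1..n} \<union> a'' ` {1..n}. b \<in> interior (f ` K))"
    using B_fixes unfolding fixes_body_def by (elim conjE exE)
  \<comment> \<open>The neighbourhood \<open>V\<close> depends on the points chosen in
    \<open>W i \<inter> W' i\<close>, so the angle is chosen last and is common to both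
    centres.\<close>
  have "\<forall>\<^sub>F q in at_right 0. (\<forall>i\<in>{1..n}. \<forall>b\<in>W i \<inter> frontier K. b \<notin> interior (rotation_about (s * q) c ` K)) \<and>
      (\<forall>i\<in>{1..n}. \<forall>b\<in>W' i \<inter> frontier K. b \<notin> interior (rotation_about (s * q) c' ` K)) \<and>
      rotation_about (s * q) c \<in> V \<and> rotation_about (s * q) c' \<in> V \<and> q > 0"
    using W W' eventually_rotation_about[OF V(1,2)]
    by (intro eventually_conj eventually_ball_finite eventually_at_right_less) auto
  then have "\<exists>q. (\<forall>i\<in>{1..n}. \<forall>b\<in>W i \<inter> frontier K. b \<notin> interior (rotation_about (s * q) c ` K)) \<and>
      (\<forall>i\<in>{1..n}. \<forall>b\<in>W' i \<inter> frontier K. b \<notin> interior (rotation_about (s * q) c' ` K)) \<and>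
      rotation_about (s * q) c \<in> V \<and> rotation_about (s * q) c' \<in> V \<and> q > 0"
    by (rule eventually_happens'[OF trivial_limit_at_right_real])
  then obtain q where
    q: "\<forall>i\<in>{1..n}. \<forall>b\<in>W i \<inter> frontier K. b \<notin> interior (rotation_about (s * q) c ` K)"
      "\<forall>i\<in>{1..n}. \<forall>b\<in>W' i \<inter> frontier K. b \<notin> interior (rotation_about (s * q) c' ` K)"
      "rotation_about (s * q) c \<in> V" "rotation_about (s * q) c' \<in> V" "q > 0"
    by (elim exE conjE)
  have "rotation_about (s * q) c ` K = K" "rotation_about (s * q) c' ` K = K"
    using bspec[OF V(3) q(3)] bspec[OF V(3) q(4)] q(1,2) a' by blast+
  then have "c = c'"
    using rotation_about_two_centres[of "s * q"] s q(5) by auto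
  then show False using c'(2) by simp
qed

end

theorem theorem8:
  fixes K :: "(real^2) set" and n :: nat and a :: "nat \<Rightarrow> real^2"
  assumes "compact K" and "convex K" and "interior K \<noteq> {}"
    and "\<And>i. i \<in> {1..n} \<Longrightarrow> a i \<in> frontier K"
  shows "(almost_fixes_body K n a \<longrightarrow>
            (\<Inter>i\<in>{1..n}. left_sector K (a i)) = {} \<and>
            (\<Inter>i\<in>{1..n}. right_sector K (a i)) = {}) \<and>
         ((\<Inter>i\<in>{1..n}. closure (left_sector K (a i))) = {} \<and>
          (\<Inter>i\<in>{1..n}. closure (right_sector K (a i))) = {} \<and>
          (\<Inter>i\<in>{1..n}. left_directions K (a i)) = {} \<longrightarrow>
            almost_fixes_body K n a)"
proof -
  interpret planar_body K using assms(1-3) by unfold_locales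
  \<comment> \<open>As finite intersections of open sets these can serve as the set of centres, with
    sign 1 for the left sectors and -1 for the right ones.\<close>
  have "open (\<Inter>i\<in>{1..n}. left_sector K (a i))" "open (\<Inter>i\<in>{1..n}. right_sector K (a i))"
    by (intro open_INT finite_atLeastAtMost ballI open_left_sector open_right_sector)+
  note open_sectors = this
  have "(\<Inter>i\<in>{1..n}. left_sector K (a i)) = {}" if "almost_fixes_body K n a"
  proof (rule ccontr)
    assume "(\<Inter>i\<in>{1..n}. left_sector K (a i)) \<noteq> {}"
    with open_sectors(1) have "\<not> almost_fixes_body K n a"
    proof (rule not_almost_fixes_body_if_sectors_meet[of 1, rotated])
      fix c i assume "c \<in> (\<Inter>i\<in>{1..n}. left_sector K (a i))" "i \<in> {1..n}"
      then have "c \<in> left_sector K (a i)" by blast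
      then show "1 * (left_tangent K (a i) \<bullet> (c - a i)) < 0 \<and> 1 * (right_tangent K (a i) \<bullet> (c - a i)) < 0"
        by (simp add: left_sector_eq)
    qed simp
    with that show False by blast
  qed
  moreover have "(\<Inter>i\<in>{1..n}. right_sector K (a i)) = {}" if "almost_fixes_body K n a"
  proof (rule ccontr)
    assume "(\<Inter>i\<in>{1..n}. right_sector K (a i)) \<noteq> {}"
    with open_sectors(2) have "\<not> almost_fixes_body K n a"
    proof (rule not_almost_fixes_body_if_sectors_meet[of "-1", rotated])
      fix c i assume "c \<in> (\<Inter>i\<in>{1..n}. right_sector K (a i))" "i \<in> {1..n}"
      then have "c \<in> right_sector K (a i)" by blast
      then show "-1 * (left_tangent K (a i) \<bullet> (c - a i)) < 0 \<and> -1 * (right_tangent K (a i) \<bullet> (c - a i)) < 0"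
        by (simp add: right_sector_eq)
    qed simp
    with that show False by blast
  qed
  ultimately show ?thesis
    using almost_fixes_body_if_sectors_disjoint assms(4) by blast
qed

end
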